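(* For any linear-span randomized first-order algorithm $\mathcal{A}$ and any $L>0$, $\sigma>0$, integer $n\ge1$, $\Delta>0$ and $\epsilon>0$ which satisfy $\epsilon^2 \leq \min\{\Delta L n^{-1},\ \Delta\sigma\}/10^3$, there exist a dimension $d = O\big(\frac{\Delta}{\epsilon^2}\min\{\sqrt{n\sigma L},\ L\}\big)$ and functions $f_1,\dots,f_n:\mathbb{R}^d \rightarrow \mathbb{R}$, with average $F=\frac1n\sum_{i=1}^n f_i$, which satisfy that each $f_i \in \mathcal{S}^{(-\sigma, L)}$ and $F(\mathbf{x}^{(0)}) - \inf_{\mathbf{x} \in \mathbb{R}^d} F(\mathbf{x}) \leq \Delta$, such that, in order to find $\hat{\mathbf{x}} \in \mathbb{R}^d$ with $\mathbb{E}\|\nabla F(\hat{\mathbf{x}})\|_2 \leq \epsilon$, $\mathcal{A}$ needs at least $$\Omega\bigg(\frac{\Delta}{\epsilon^2}\min\big\{\sqrt{n\sigma L},\ L\big\}\bigg)$$ IFO calls.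
   Context: $O(\cdot)$ and $\Omega(\cdot)$ hide universal multiplicative constants. Smoothness: for $l\in\mathbb{R}$, $L>0$, a differentiable $f:\mathbb{R}^m\to\mathbb{R}$ is $(l,L)$-smooth, written $f\in\mathcal{S}^{(l,L)}$, if for all $\mathbf{x},\mathbf{y}\in\mathbb{R}^m$, $\frac l2\|\mathbf{x}-\mathbf{y}\|_2^2\le f(\mathbf{x})-f(\mathbf{y})-\langle\nabla f(\mathbf{y}),\mathbf{x}-\mathbf{y}\rangle\le\frac L2\|\mathbf{x}-\mathbf{y}\|_2^2$. Oracle: given $\mathbf{x}$ and $i\in[n]=\{1,\dots,n\}$, the Incremental First-order Oracle (IFO) returns $[f_i(\mathbf{x}),\nabla f_i(\mathbf{x})]$. Algorithm class: given an initial point $\mathbf{x}^{(0)}$, a linear-span randomized first-order algorithm $\mathcal{A}$ is a measurable mapping from functions $\{f_i\}_{i=1}^n$ to an infinite sequence of point and index pairs $\{(\mathbf{x}^{(t)},i_t)\}_{t=0}^\infty$ with random variables $i_t\in[n]$, satisfying $\mathbf{x}^{(t+1)}\in\mathrm{Lin}\{\mathbf{x}^{(0)},\dots,\mathbf{x}^{(t)},\nabla f_{i_0}(\mathbf{x}^{(0)}),\dots,\nabla f_{i_t}(\mathbf{x}^{(t)})\}$, where $\mathrm{Lin}$ denotes linear span. The algorithm is defined in every dimension $d$, with an initial point $\mathbf{x}^{(0)}\in\mathbb{R}^d$. Counting: one IFO call (at $\mathbf{x}^{(t)}$ with index $i_t$) is made per step, so $\mathbf{x}^{(t)}$ is the output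 after $t$ IFO calls. "$\mathcal{A}$ needs at least $N$ IFO calls to find $\hat{\mathbf{x}}$ with a given property" means that no output $\hat{\mathbf{x}}=\mathbf{x}^{(t)}$ with $t<N$ has the property. Expectation $\mathbb{E}$ is over the randomness of the algorithm. *)

theory Defs
  imports "HOL-Probability.Probability"
begin

text \<open>
  The dimension \<open>d\<close> is chosen inside the statement, so \<open>\<real>\<^sup>d\<close> cannot be a type.  It is
  represented as the coordinate subspace \<open>Rn d\<close> (first \<open>d\<close> coordinates) of the inner product
  space of finitely supported real sequences, and carries the usual dot product, norm, span,
  topology and derivative (taken within \<open>Rn d\<close>).
\<close>

typedef rvec = "{x :: nat \<Rightarrow> real. finite {k. x k \<noteq> 0}}"
  morphisms coord Abs_rvec
  by (rule exI[of _ "\<lambda>_. 0"]) simp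

lemma finite_coord: "finite {k. coord x k \<noteq> 0}"
  using coord by auto

lemma rvec_eq_iff: "x = y \<longleftrightarrow> (\<forall>k. coord x k = coord y k)"
  by (metis coord_inject ext)

lemma coord_Abs: "finite {k. f k \<noteq> 0} \<Longrightarrow> coord (Abs_rvec f) k = f k"
  by (simp add: Abs_rvec_inverse)

instantiation rvec :: real_vector
begin

definition zero_rvec where "0 = Abs_rvec (\<lambda>_. 0)"
definition plus_rvec where "x + y = Abs_rvec (\<lambda>k. coord x k + coord y k)"
definition minus_rvec where "x - y = Abs_rvec (\<lambda>k. coord x k - coord y k)"
definition uminus_rvec where "- x = Abs_rvec (\<lambda>k. - coord x k)"
definition scaleR_rvec where "scaleR c x = Abs_rvec (\<lambda>k. c * coord x k)"

lemma coord_zero [simp]: "coord 0 k = 0"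
  by (simp add: zero_rvec_def coord_Abs)

lemma coord_add [simp]: "coord (x + y) k = coord x k + coord y k"
  unfolding plus_rvec_def
  by (intro coord_Abs finite_subset[OF _ finite_UnI[OF finite_coord[of x] finite_coord[of y]]]) auto

lemma coord_diff [simp]: "coord (x - y) k = coord x k - coord y k"
  unfolding minus_rvec_def
  by (intro coord_Abs finite_subset[OF _ finite_UnI[OF finite_coord[of x] finite_coord[of y]]]) auto

lemma coord_minus [simp]: "coord (- x) k = - coord x k"
  unfolding uminus_rvec_def by (intro coord_Abs finite_subset[OF _ finite_coord[of x]]) auto

lemma coord_scaleR [simp]: "coord (scaleR c x) k = c * coord x k"
  unfolding scaleR_rvec_def by (intro coord_Abs finite_subset[OF _ finite_coord[of x]]) auto

instance
  by standard (auto simp: rvec_eq_iff algebra_simps)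

end

instantiation rvec :: real_normed_vector
begin

definition norm_rvec where
  "norm x = sqrt (\<Sum>k\<in>{k. coord x k \<noteq> 0}. (coord x k)\<^sup>2)"
definition dist_rvec where "dist x y = norm (x - y :: rvec)"
definition sgn_rvec where "sgn x = scaleR (inverse (norm x)) (x :: rvec)"
definition uniformity_rvec where
  "(uniformity :: (rvec \<times> rvec) filter) = (INF e\<in>{0<..}. principal {(x, y). dist x y < e})"
definition open_rvec where
  "open (U :: rvec set) \<longleftrightarrow> (\<forall>x\<in>U. eventually (\<lambda>(x', y). x' = x \<longrightarrow> y \<in> U) uniformity)"

lemma norm_rvec_eq:
  assumes "finite S" "\<And>k. k \<notin> S \<Longrightarrow> coord x k = 0"
  shows "norm x = L2_set (coord x) S"
  unfolding norm_rvec_def L2_set_def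
  by (intro arg_cong[of _ _ sqrt] sum.mono_neutral_left) (use assms in auto)

instance
proof
  fix x y :: rvec and r :: real and U :: "rvec set"
  let ?S = "{k. coord x k \<noteq> 0} \<union> {k. coord y k \<noteq> 0}"
  have fin: "finite ?S" using finite_coord by blast
  show "dist x y = norm (x - y)" by (rule dist_rvec_def)
  show "sgn x = inverse (norm x) *\<^sub>R x" by (rule sgn_rvec_def)
  show "uniformity = (INF e\<in>{0<..}. principal {(x :: rvec, y). dist x y < e})"
    by (rule uniformity_rvec_def)
  show "open U \<longleftrightarrow> (\<forall>x\<in>U. eventually (\<lambda>(x', y). x' = x \<longrightarrow> y \<in> U) uniformity)"
    by (rule open_rvec_def)
  have xy: "norm x = L2_set (coord x) ?S" "norm y = L2_set (coord y) ?S"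
    "norm (x + y) = L2_set (coord (x + y)) ?S"
    "norm (r *\<^sub>R x) = L2_set (coord (r *\<^sub>R x)) ?S"
    by (auto intro!: norm_rvec_eq[OF fin])
  show "norm x = 0 \<longleftrightarrow> x = 0"
    unfolding xy by (subst L2_set_eq_0_iff[OF fin]) (auto simp: rvec_eq_iff)
  show "norm (x + y) \<le> norm x + norm y"
    unfolding xy using L2_set_triangle_ineq[of "coord x" "coord y" ?S]
    by (simp cong: L2_set_cong)
  have "coord (r *\<^sub>R x) = (\<lambda>k. r * coord x k)" by auto
  then show "norm (r *\<^sub>R x) = \<bar>r\<bar> * norm x"
    unfolding xy
    by (simp add: L2_set_def power_mult_distrib real_sqrt_mult flip: sum_distrib_left)
qed

end

instantiation rvec :: real_inner
begin

definition inner_rvec where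
  "inner x y = (\<Sum>k\<in>{k. coord x k \<noteq> 0 \<and> coord y k \<noteq> 0}. coord x k * coord y k)"

lemma inner_rvec_eq:
  assumes "finite S" "\<And>k. k \<notin> S \<Longrightarrow> coord x k = 0 \<or> coord y k = 0"
  shows "inner x y = (\<Sum>k\<in>S. coord x k * coord y k)"
  unfolding inner_rvec_def by (rule sum.mono_neutral_left) (use assms in auto)

instance
proof
  fix x y z :: rvec and r :: real
  let ?S = "{k. coord x k \<noteq> 0} \<union> {k. coord y k \<noteq> 0} \<union> {k. coord z k \<noteq> 0}"
  have fin: "finite ?S" using finite_coord by blast
  show "inner x y = inner y x"
    unfolding inner_rvec_def by (rule sum.cong) auto
  have xy: "inner x z = (\<Sum>k\<in>?S. coord x k * coord z k)"
    "inner y z = (\<Sum>k\<in>?S. coord y k * coord z k)"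
    "inner x y = (\<Sum>k\<in>?S. coord x k * coord y k)"
    "inner (x + y) z = (\<Sum>k\<in>?S. coord (x + y) k * coord z k)"
    "inner (r *\<^sub>R x) y = (\<Sum>k\<in>?S. coord (r *\<^sub>R x) k * coord y k)"
    by (rule inner_rvec_eq[OF fin]; auto)+
  show "inner (x + y) z = inner x z + inner y z"
    unfolding xy by (simp add: sum.distrib algebra_simps)
  show "inner (r *\<^sub>R x) y = r * inner x y"
    unfolding xy by (simp add: sum_distrib_left algebra_simps)
  have xx: "inner x x = (\<Sum>k\<in>{k. coord x k \<noteq> 0}. coord x k * coord x k)"
    by (auto intro: inner_rvec_eq[OF finite_coord])
  show "norm x = sqrt (inner x x)"
    unfolding xx norm_rvec_def by (simp add: power2_eq_square)
  show "0 \<le> inner x x"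
    unfolding xx by (intro sum_nonneg) auto
  show "inner x x = 0 \<longleftrightarrow> x = 0"
    unfolding xx using finite_coord[of x]
    by (subst sum_nonneg_eq_0_iff) (auto simp: rvec_eq_iff)
qed

end

definition Rn :: "nat \<Rightarrow> rvec set" where
  "Rn d = {x. \<forall>k\<ge>d. coord x k = 0}"

lemma inner_Rn: "x \<in> Rn d \<Longrightarrow> inner x y = (\<Sum>k<d. coord x k * coord y k)"
  by (rule inner_rvec_eq) (auto simp: Rn_def not_less)

lemma norm_Rn: "x \<in> Rn d \<Longrightarrow> norm x = L2_set (coord x) {..<d}"
  by (rule norm_rvec_eq) (auto simp: Rn_def not_less)

lemma subspace_Rn: "subspace (Rn d)"
  by (auto simp: subspace_def Rn_def)

definition gradient :: "nat \<Rightarrow> (rvec \<Rightarrow> real) \<Rightarrow> rvec \<Rightarrow> rvec" where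
  "gradient d f x =
     (THE g. g \<in> Rn d \<and> (f has_derivative (\<lambda>h. inner g h)) (at x within Rn d))"

definition basis :: "nat \<Rightarrow> rvec" where
  "basis i = Abs_rvec (\<lambda>k. if k = i then 1 else 0)"

lemma coord_basis [simp]: "coord (basis i) k = (if k = i then 1 else 0)"
  unfolding basis_def by (rule coord_Abs) simp

lemma coord_sum [simp]: "coord (sum g A) k = (\<Sum>a\<in>A. coord (g a) k)"
  by (induction A rule: infinite_finite_induct) auto

lemma Rn_expansion: "h \<in> Rn d \<Longrightarrow> h = (\<Sum>k<d. coord h k *\<^sub>R basis k)"
  by (auto simp: rvec_eq_iff Rn_def not_less if_distrib sum.delta cong: if_cong)

text \<open>\<open>gradient\<close> is well defined: derivatives within \<open>Rn d\<close> are unique on \<open>Rn d\<close>.\<close>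

lemma gradient_unique:
  assumes x: "x \<in> Rn d" and g: "g \<in> Rn d" and g': "g' \<in> Rn d"
    and D: "(f has_derivative (\<lambda>h. inner g h)) (at x within Rn d)"
    and D': "(f has_derivative (\<lambda>h. inner g' h)) (at x within Rn d)"
  shows "g = g'"
proof -
  define v where "v = g - g'"
  have v: "v \<in> Rn d" unfolding v_def using g g' subspace_Rn subspace_diff by blast
  let ?p = "\<lambda>t::real. x + t *\<^sub>R v"
  have p: "?p ` UNIV \<subseteq> Rn d"
    using x v by (auto simp: Rn_def)
  have dp: "(?p has_derivative (\<lambda>t. t *\<^sub>R v)) (at 0)"
    by (auto intro!: derivative_eq_intros)
  have *: "((f \<circ> ?p) has_derivative ((\<lambda>h. inner a h) \<circ> (\<lambda>t. t *\<^sub>R v))) (at 0)"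
    if "(f has_derivative (\<lambda>h. inner a h)) (at x within Rn d)" for a
    by (rule diff_chain_within[OF dp]) (use that p in \<open>auto intro: has_derivative_subset\<close>)
  have "(\<lambda>h. inner g h) \<circ> (\<lambda>t. t *\<^sub>R v) = (\<lambda>h. inner g' h) \<circ> (\<lambda>t. t *\<^sub>R v)"
    by (rule has_derivative_unique[OF *[OF D] *[OF D']])
  from fun_cong[OF this, of 1] have "inner v v = 0"
    by (simp add: v_def inner_diff_left)
  then show ?thesis by (simp add: v_def)
qed

lemma gradient_eqI:
  assumes "x \<in> Rn d" "g \<in> Rn d" "(f has_derivative (\<lambda>h. inner g h)) (at x within Rn d)"
  shows "gradient d f x = g"
  unfolding gradient_def using assms by (blast intro: gradient_unique)

lemma has_derivative_gradient:
  assumes "f differentiable (at x within Rn d)" "x \<in> Rn d"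
  shows "gradient d f x \<in> Rn d"
    "(f has_derivative (\<lambda>h. inner (gradient d f x) h)) (at x within Rn d)"
proof -
  obtain f' where f': "(f has_derivative f') (at x within Rn d)"
    using assms(1) by (auto simp: differentiable_def)
  interpret f': bounded_linear f' using f' by (rule has_derivative_bounded_linear)
  define g where "g = (\<Sum>k<d. f' (basis k) *\<^sub>R basis k)"
  have g: "g \<in> Rn d"
    by (auto simp: g_def Rn_def intro!: sum.neutral)
  have eq: "inner g h = f' h" if h: "h \<in> Rn d" for h
  proof -
    have "f' h = (\<Sum>k<d. coord h k * f' (basis k))"
      by (subst Rn_expansion[OF h]) (simp add: f'.sum f'.scaleR)
    also have "\<dots> = inner g h"
      unfolding inner_Rn[OF g]
      by (intro sum.cong) (auto simp: g_def if_distrib sum.delta cong: if_cong)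
    finally show ?thesis ..
  qed
  have "(f has_derivative (\<lambda>h. inner g h)) (at x within Rn d)"
    unfolding has_derivative_within
  proof
    show "bounded_linear (\<lambda>h. inner g h)" by (rule bounded_linear_inner_right)
    have "((\<lambda>y. (1 / norm (y - x)) *\<^sub>R (f y - (f x + f' (y - x)))) \<longlongrightarrow> 0) (at x within Rn d)"
      using f' by (simp add: has_derivative_within)
    moreover have "\<forall>\<^sub>F y in at x within Rn d.
        (1 / norm (y - x)) *\<^sub>R (f y - (f x + f' (y - x))) =
        (1 / norm (y - x)) *\<^sub>R (f y - (f x + inner g (y - x)))"
      unfolding eventually_at_filter
      by (rule always_eventually) (use eq subspace_diff[OF subspace_Rn] assms(2) in auto)
    ultimately show "((\<lambda>y. (1 / norm (y - x)) *\<^sub>R (f y - (f x + inner g (y - x)))) \<longlongrightarrow> 0)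
        (at x within Rn d)"
      by (rule Lim_transform_eventually)
  qed
  with gradient_eqI[OF assms(2) g this] g
  show "gradient d f x \<in> Rn d"
    "(f has_derivative (\<lambda>h. inner (gradient d f x) h)) (at x within Rn d)"
    by auto
qed

definition smooth_class :: "nat \<Rightarrow> real \<Rightarrow> real \<Rightarrow> (rvec \<Rightarrow> real) set" where
  "smooth_class d l L = {f. f differentiable_on Rn d \<and>
     (\<forall>x\<in>Rn d. \<forall>y\<in>Rn d.
        l / 2 * (norm (x - y))\<^sup>2 \<le> f x - f y - inner (gradient d f y) (x - y) \<and>
        f x - f y - inner (gradient d f y) (x - y) \<le> L / 2 * (norm (x - y))\<^sup>2)}"

definition average :: "nat \<Rightarrow> (nat \<Rightarrow> rvec \<Rightarrow> real) \<Rightarrow> rvec \<Rightarrow> real" where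
  "average n f x = (\<Sum>i\<in>{1..n}. f i x) / real n"

text \<open>
  An algorithm maps a dimension \<open>d\<close> and functions \<open>f 1, \<dots>, f n\<close> on \<open>Rn d\<close> to a random
  sequence of pairs \<open>(x\<^sup>(\<^sup>t\<^sup>), i\<^sub>t)\<close>.  The random sequence is given by its law, a probability measure
  on the sequence space; the random variables are the coordinates of a sample \<open>\<omega>\<close>.  Any
  choice of underlying sample space induces such a law.
  The initial point in dimension \<open>d\<close> is \<open>x0 d\<close>.
\<close>

type_synonym algorithm =
  "nat \<Rightarrow> (nat \<Rightarrow> rvec \<Rightarrow> real) \<Rightarrow> (nat \<Rightarrow> rvec \<times> nat) measure"

abbreviation point :: "(nat \<Rightarrow> rvec \<times> nat) \<Rightarrow> nat \<Rightarrow> rvec" where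
  "point \<omega> t \<equiv> fst (\<omega> t)"

abbreviation index :: "(nat \<Rightarrow> rvec \<times> nat) \<Rightarrow> nat \<Rightarrow> nat" where
  "index \<omega> t \<equiv> snd (\<omega> t)"

definition linear_span_algorithm :: "nat \<Rightarrow> (nat \<Rightarrow> rvec) \<Rightarrow> algorithm \<Rightarrow> bool" where
  "linear_span_algorithm n x0 A \<longleftrightarrow>
     (\<forall>d. x0 d \<in> Rn d \<and>
       (\<forall>f. (\<forall>i\<in>{1..n}. f i differentiable_on Rn d) \<longrightarrow>
          prob_space (A d f) \<and>
          sets (A d f) = sets (\<Pi>\<^sub>M t\<in>UNIV. borel \<Otimes>\<^sub>M count_space UNIV) \<and>
          (AE \<omega> in A d f.
             point \<omega> 0 = x0 d \<and>
             (\<forall>t. index \<omega> t \<in> {1..n} \<and>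
                  point \<omega> (Suc t) \<in> span
                    ((\<lambda>s. point \<omega> s) ` {..t} \<union>
                     (\<lambda>s. gradient d (f (index \<omega> s)) (point \<omega> s)) ` {..t})))))"

text \<open>
  \<open>\<bbbE>\<parallel>\<nabla>F(x\<^sup>(\<^sup>t\<^sup>))\<parallel>\<close>, as a nonnegative integral so that a non-integrable norm gives \<open>\<infinity>\<close>
  (the Bochner integral would give \<open>0\<close>).
\<close>

definition expected_gradient_norm ::
    "nat \<Rightarrow> (rvec \<Rightarrow> real) \<Rightarrow> (nat \<Rightarrow> rvec \<times> nat) measure \<Rightarrow> nat \<Rightarrow> ennreal" where
  "expected_gradient_norm d F M t = (\<integral>\<^sup>+ \<omega>. ennreal (norm (gradient d F (point \<omega> t))) \<partial>M)"

end

theory Submission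
  imports Defs
begin

text \<open>
  Each component \<open>i\<close> owns a chain of \<open>T\<close> coordinates, coupled by springs of strength \<open>K\<close>, of
  the order of \<open>L\<close>.  The first coordinate is attached by a weaker spring to a point away from
  \<open>0\<close>, and every coordinate sits in a well that prefers the value \<open>1\<close> but is flat at \<open>0\<close>.  From the starting point,
  where all coordinates are \<open>0\<close>, a call to component \<open>i\<close> can make at most one more coordinate of
  chain \<open>i\<close> nonzero, however the indices are chosen (\<open>trajectory_reached\<close>).  So with fewer than
  \<open>n T / 2\<close> calls more than half of the chains still end in \<open>0\<close>.

  Such a chain is out of equilibrium: between its pulled left end and its right end at \<open>0\<close> the
  forces have Euclidean norm at least a constant times \<open>s\<^bsup>3/4\<^esup> K\<^bsup>1/4\<^esup>\<close>, where \<open>s\<close> is the strength of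
  the wells.  This is \<open>chain_force_lower_bound\<close>, with \<open>\<theta> = \<surd>(s / K)\<close>; the natural width of the
  transition from \<open>1/2\<close> to \<open>0\<close> is \<open>1 / \<theta>\<close> sites.  It is proved by pairing the forces with a test vector \<open>w\<close>
  whose second differences are at most \<open>\<theta>\<^sup>2 w\<close>.

  Negative curvature comes from the wells alone.  They are shared by all components, each carrying a
  fraction \<open>1 / n\<close>, while the springs of a chain belong to a single component.  Hence \<open>s\<close> may be as
  large as \<open>n \<sigma>\<close> although every component has curvature at least \<open>- \<sigma>\<close>.  For an initial gap
  \<open>\<Delta>\<close> and gradients of size \<open>\<epsilon>\<close>, this allows chains with \<open>n T\<close> of the order
  \<open>\<Delta> \<surd>(K s) / \<epsilon>\<^sup>2\<close>, and \<open>\<surd>(K s)\<close> is of the order \<open>min (\<surd>(n \<sigma> L)) L\<close>.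
  The dimension is \<open>n T + 1\<close>: all chain directions are chosen orthogonal to the starting point, since
  the algorithm may move along that direction without any call.
\<close>

section \<open>A potential with a flat point at the origin\<close>

text \<open>
  A potential with an inflection point at \<open>0\<close> and its only minimum, of value \<open>0\<close>,
  at \<open>1\<close>.  Adding \<open>y\<^sup>2 / 2\<close> leaves a sum of two squared hinges, hence a convex function.
\<close>

definition well :: "real \<Rightarrow> real" where
  "well y = 1/4 - y\<^sup>2 / 2 + (max 0 (y - 1/2))\<^sup>2 + (min 0 y)\<^sup>2"

definition well_slope :: "real \<Rightarrow> real" where
  "well_slope y = - y + 2 * max 0 (y - 1/2) + 2 * min 0 y"

text \<open>
  Two facts about the slope drive the whole construction.  It vanishes at \<open>0\<close>, so a coordinate that
  is still \<open>0\<close> stays invisible; and below \<open>1/2\<close> it has the constant sign and the linear size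
  \<open>\<bar>y\<bar>\<close>, which is what a test vector with second differences of size \<open>\<theta>\<^sup>2 w\<close> can absorb.
\<close>

lemma well_slope_below_half: "y \<le> 1/2 \<Longrightarrow> well_slope y = - \<bar>y\<bar>"
  by (simp add: well_slope_def max_def min_def)

lemma well_nonneg: "0 \<le> well y"
proof (cases "y \<le> 1/2")
  case True
  show ?thesis
  proof (cases "y \<le> 0")
    case True
    then show ?thesis by (simp add: well_def max_def min_def)
  next
    case False
    then have "y\<^sup>2 \<le> (1/2)\<^sup>2" using True by (intro power_mono) auto
    then show ?thesis using False True by (simp add: well_def max_def min_def power2_eq_square)
  qed
next
  case False
  then have "well y = (y - 1)\<^sup>2 / 2"
    by (simp add: well_def max_def min_def power2_eq_square algebra_simps)
  also have "\<dots> \<ge> 0" by simp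
  finally show ?thesis .
qed

text \<open>
  Both curvature bounds come from the hinge part \<open>r\<close> of the potential: it suffices that its
  linearisation error lies between \<open>0\<close> and \<open>(x - y)\<^sup>2\<close>.  The hinges are active on the disjoint half-lines
  \<open>y \<le> 0\<close> and \<open>y > 1/2\<close>, so the curvature of \<open>r\<close> never exceeds \<open>2\<close>; the case distinction
  follows these two thresholds.
\<close>

lemma well_quadratic_bound:
  "\<bar>well x - well y - well_slope y * (x - y)\<bar> \<le> (x - y)\<^sup>2 / 2"
proof -
  define r where "r = (\<lambda>t::real. (max 0 (t - 1/2))\<^sup>2 + (min 0 t)\<^sup>2)"
  define r' where "r' = (\<lambda>t::real. 2 * max 0 (t - 1/2) + 2 * min 0 t)"
  have eq: "well x - well y - well_slope y * (x - y) = r x - r y - r' y * (x - y) - (x - y)\<^sup>2 / 2"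
    by (simp add: well_def well_slope_def r_def r'_def power2_eq_square field_simps)
  have r: "t \<le> 0 \<Longrightarrow> r t = t\<^sup>2" "0 < t \<Longrightarrow> t \<le> 1/2 \<Longrightarrow> r t = 0" "1/2 < t \<Longrightarrow> r t = (t - 1/2)\<^sup>2"
    "t \<le> 0 \<Longrightarrow> r' t = 2 * t" "0 < t \<Longrightarrow> t \<le> 1/2 \<Longrightarrow> r' t = 0" "1/2 < t \<Longrightarrow> r' t = 2 * (t - 1/2)" for t
    by (auto simp: r_def r'_def max_def min_def)
  have cas: "t \<le> 0 \<or> 0 < t \<and> t \<le> 1/2 \<or> 1/2 < t" for t :: real by linarith
  have nonneg: "0 \<le> (x - y)\<^sup>2" "0 \<le> x\<^sup>2" "0 \<le> y\<^sup>2" "0 \<le> (x - 1/2)\<^sup>2" "0 \<le> (y - 1/2)\<^sup>2" by simp_all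
  have "0 \<le> r x - r y - r' y * (x - y) \<and> r x - r y - r' y * (x - y) \<le> (x - y)\<^sup>2"
    using cas[of x] cas[of y]
  proof (elim disjE conjE)
    assume h: "x \<le> 0" "1/2 < y"
    then have "(1/2 - x)\<^sup>2 \<le> (y - x)\<^sup>2" by (intro power_mono) auto
    moreover have "0 \<le> x * x" by simp
    ultimately have "0 \<le> (x - y)\<^sup>2 + x - 1/4"
      unfolding power2_eq_square left_diff_distrib right_diff_distrib by linarith
    then show ?thesis using h by (simp add: r power2_eq_square algebra_simps)
  next
    assume h: "0 < x" "x \<le> 1/2" "1/2 < y"
    then have "(y - 1/2) * (x - 1/2) \<le> 0" by (intro mult_nonneg_nonpos) auto
    then show ?thesis using h nonneg by (simp add: r power2_eq_square algebra_simps)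
  next
    assume h: "1/2 < x" "0 < y" "y \<le> 1/2"
    then have "(x - 1/2) * (y - 1/2) \<le> 0" by (intro mult_nonneg_nonpos) auto
    then show ?thesis using h nonneg by (simp add: r power2_eq_square algebra_simps)
  next
    assume h: "1/2 < x" "y \<le> 0"
    then have "x * y \<le> 0" by (intro mult_nonneg_nonpos) auto
    moreover have "0 \<le> y * y" by simp
    ultimately have "0 \<le> (x - 1/2)\<^sup>2 + y\<^sup>2 - 2 * (x * y)"
      using nonneg(4) unfolding power2_eq_square by linarith
    then show ?thesis using h by (simp add: r power2_eq_square algebra_simps)
  next
    assume h: "x \<le> 0" "0 < y" "y \<le> 1/2"
    then have "y * x \<le> 0" by (intro mult_nonneg_nonpos) auto
    then show ?thesis using h nonneg by (simp add: r power2_eq_square algebra_simps)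
  next
    assume h: "0 < x" "x \<le> 1/2" "y \<le> 0"
    then have "x * y \<le> 0" by (intro mult_nonneg_nonpos) auto
    moreover have "0 \<le> y * y" by simp
    ultimately have "2 * (x * y) \<le> y * y" by linarith
    then show ?thesis using h by (simp add: r power2_eq_square algebra_simps)
  qed (use nonneg in \<open>simp_all add: r power2_eq_square algebra_simps\<close>)
  then show ?thesis unfolding eq by (intro abs_leI) auto
qed

section \<open>The forces on an incomplete chain\<close>

text \<open>
  The test vector: it rises with slope about \<open>3/4 \<theta>\<close> at \<open>j = 0\<close>, turns around after about
  \<open>1/\<theta>\<close> steps and then decays geometrically.  A double characteristic root makes all second
  differences computable in closed form.
\<close>

definition weight :: "real \<Rightarrow> nat \<Rightarrow> real" where
  "weight \<theta> j = (1 + 5/4 * \<theta> * real j) / (1 + \<theta> / 2) ^ j"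

lemma weight_nonneg: "0 \<le> \<theta> \<Longrightarrow> 0 \<le> weight \<theta> j"
  by (simp add: weight_def)

text \<open>
  Multiplied by \<open>(1 + \<theta>/2)\<^bsup>j+2\<^esup>\<close>, the second difference is exactly \<open>\<theta>\<^sup>2 (a - 5) / 4\<close> with
  \<open>a = 1 + 5/4 \<theta> j\<close>.  Since \<open>a \<ge> 1\<close>, its absolute value is at most \<open>\<theta>\<^sup>2 a\<close>; the factor
  \<open>5/4\<close> in the weight is the largest one for which this holds for all small \<open>\<theta>\<close>.
\<close>

lemma weight_second_difference:
  assumes "0 \<le> \<theta>"
  shows "\<bar>weight \<theta> j - 2 * weight \<theta> (Suc j) + weight \<theta> (Suc (Suc j))\<bar> \<le> \<theta>\<^sup>2 * weight \<theta> (Suc j)"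
proof -
  define P where "P = 1 + \<theta> / 2"
  define a where "a = 1 + 5/4 * \<theta> * real j"
  have P: "P \<ge> 1" and a: "a \<ge> 1" using assms by (auto simp: P_def a_def)
  have pos: "0 < P ^ Suc (Suc j)" using P by simp
  have w: "weight \<theta> j = a * P\<^sup>2 / P ^ Suc (Suc j)"
    "weight \<theta> (Suc j) = (a + 5/4 * \<theta>) * P / P ^ Suc (Suc j)"
    "weight \<theta> (Suc (Suc j)) = (a + 5/2 * \<theta>) / P ^ Suc (Suc j)"
    using P unfolding weight_def P_def[symmetric] a_def
    by (simp_all add: field_simps power2_eq_square)
  have "weight \<theta> j - 2 * weight \<theta> (Suc j) + weight \<theta> (Suc (Suc j))
      = (a * P\<^sup>2 - 2 * ((a + 5/4 * \<theta>) * P) + (a + 5/2 * \<theta>)) / P ^ Suc (Suc j)"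
    unfolding w by (simp add: diff_divide_distrib add_divide_distrib)
  also have "a * P\<^sup>2 - 2 * ((a + 5/4 * \<theta>) * P) + (a + 5/2 * \<theta>) = \<theta>\<^sup>2 * ((a - 5) / 4)"
    unfolding P_def by (simp add: power2_eq_square algebra_simps)
  finally have eq: "weight \<theta> j - 2 * weight \<theta> (Suc j) + weight \<theta> (Suc (Suc j))
      = \<theta>\<^sup>2 * ((a - 5) / 4) / P ^ Suc (Suc j)" .
  have "a \<le> (a + 5/4 * \<theta>) * P"
    using mult_mono[of a "a + 5/4 * \<theta>" 1 P] a P assms by simp
  then have "\<bar>(a - 5) / 4\<bar> \<le> (a + 5/4 * \<theta>) * P" using a by (simp add: abs_le_iff)
  then have "\<theta>\<^sup>2 * \<bar>(a - 5) / 4\<bar> / P ^ Suc (Suc j)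
      \<le> \<theta>\<^sup>2 * ((a + 5/4 * \<theta>) * P) / P ^ Suc (Suc j)"
    using pos by (intro divide_right_mono mult_left_mono) auto
  moreover have "\<bar>\<theta>\<^sup>2 * ((a - 5) / 4) / P ^ Suc (Suc j)\<bar> = \<theta>\<^sup>2 * \<bar>(a - 5) / 4\<bar> / P ^ Suc (Suc j)"
    using pos by (simp add: abs_mult del: power_Suc)
  ultimately show ?thesis unfolding eq unfolding w(2) by (simp del: power_Suc)
qed

lemma weight_first_difference:
  assumes "0 < \<theta>" "\<theta> \<le> 1"
  shows "\<theta> / 2 \<le> weight \<theta> 1 - weight \<theta> 0" "weight \<theta> 1 - weight \<theta> 0 \<le> \<theta> * weight \<theta> 1"
proof -
  have eq: "weight \<theta> 1 - weight \<theta> 0 = 3/4 * \<theta> / (1 + \<theta> / 2)"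
    using assms by (simp add: weight_def field_simps)
  show "\<theta> / 2 \<le> weight \<theta> 1 - weight \<theta> 0"
    unfolding eq using assms by (simp add: field_simps power2_eq_square)
  show "weight \<theta> 1 - weight \<theta> 0 \<le> \<theta> * weight \<theta> 1"
    unfolding eq using assms by (simp add: weight_def field_simps)
qed

text \<open>
  The sum telescopes against the potential \<open>Q (\<theta> m) / (\<theta> (1 + \<theta>/2)\<^bsup>2m\<^esup>)\<close>.  The coefficients of \<open>Q\<close>
  are chosen so that one step of the potential decreases by at least the next term, for every
  \<open>\<theta> \<le> 1\<close>.
\<close>

lemma sum_weight_square:
  assumes "0 < \<theta>" "\<theta> \<le> 1"
  shows "(\<Sum>j=1..m. (weight \<theta> j)\<^sup>2) \<le> 12 / \<theta>"
proof -
  define P where "P = 1 + \<theta> / 2"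
  define Q where "Q = (\<lambda>x::real. 12 + 15/2 * x + 25/16 * x\<^sup>2)"
  have P: "P > 0" using assms by (simp add: P_def)
  have "(\<Sum>j=1..m. (weight \<theta> j)\<^sup>2) \<le> 12 / \<theta> - Q (\<theta> * real m) / (\<theta> * (P\<^sup>2) ^ m)"
  proof (induction m)
    case 0
    then show ?case by (simp add: Q_def)
  next
    case (Suc m)
    define x where "x = \<theta> * real m"
    have x: "x \<ge> 0" using assms by (simp add: x_def)
    have xS: "\<theta> * real (Suc m) = x + \<theta>" by (simp add: x_def algebra_simps)
    have "\<theta> * (1 + 5/4 * (x + \<theta>))\<^sup>2 \<le> Q x * P\<^sup>2 - Q (x + \<theta>)"
    proof -
      have "Q x * P\<^sup>2 - Q (x + \<theta>) - \<theta> * (1 + 5/4 * (x + \<theta>))\<^sup>2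
         = \<theta> * ((25/64) * x\<^sup>2 * \<theta> + x * (15/8 - 5/4 * \<theta>)
             + (7/2 - 17/16 * \<theta> - 25/16 * \<theta>\<^sup>2))"
        unfolding Q_def P_def by (simp add: power2_eq_square field_simps)
      moreover have "\<theta>\<^sup>2 \<le> 1" using assms by (simp add: power_le_one)
      then have "7/2 - 17/16 * \<theta> - 25/16 * \<theta>\<^sup>2 \<ge> 0" using assms by linarith
      then have "\<theta> * ((25/64) * x\<^sup>2 * \<theta> + x * (15/8 - 5/4 * \<theta>)
             + (7/2 - 17/16 * \<theta> - 25/16 * \<theta>\<^sup>2)) \<ge> 0"
        using assms x by (intro mult_nonneg_nonneg add_nonneg_nonneg) auto
      ultimately show ?thesis by linarith
    qed
    then have "\<theta> * (1 + 5/4 * (x + \<theta>))\<^sup>2 / (\<theta> * (P\<^sup>2) ^ Suc m)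
        \<le> (Q x * P\<^sup>2 - Q (x + \<theta>)) / (\<theta> * (P\<^sup>2) ^ Suc m)"
      using assms P by (intro divide_right_mono) auto
    also have "\<dots> = Q x / (\<theta> * (P\<^sup>2) ^ m) - Q (x + \<theta>) / (\<theta> * (P\<^sup>2) ^ Suc m)"
      using P assms by (simp add: diff_divide_distrib)
    finally have "\<theta> * (1 + 5/4 * (x + \<theta>))\<^sup>2 / (\<theta> * (P\<^sup>2) ^ Suc m) \<le> \<dots>" .
    moreover have "(weight \<theta> (Suc m))\<^sup>2 = \<theta> * (1 + 5/4 * (x + \<theta>))\<^sup>2 / (\<theta> * (P\<^sup>2) ^ Suc m)"
    proof -
      have "weight \<theta> (Suc m) = (1 + 5/4 * (x + \<theta>)) / P ^ Suc m"
        unfolding weight_def xS[symmetric] P_def by (simp add: algebra_simps)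
      then show ?thesis using assms
        by (simp add: power_divide power_mult[symmetric] mult.commute del: power_Suc)
    qed
    ultimately show ?case using Suc unfolding xS x_def[symmetric] by simp
  qed
  also have "\<dots> \<le> 12 / \<theta>" using assms P by (simp add: Q_def)
  finally show ?thesis .
qed

text \<open>
  The discrete Laplacian is symmetric up to the boundary terms at \<open>k\<close> and \<open>k + m + 1\<close>; only the
  term at the left end survives when \<open>y\<close> vanishes at \<open>k + m\<close> and beyond.
\<close>

lemma second_difference_by_parts:
  fixes w y :: "nat \<Rightarrow> real"
  shows "(\<Sum>j=1..m. w j * (2 * y (k + j) - y (k + j - 1) - y (k + j + 1)))
    = (\<Sum>j=1..m. y (k + j) * (2 * w j - w (j - 1) - w (j + 1)))
      + w 0 * y (k + 1) - w 1 * y k + w (m + 1) * y (k + m) - w m * y (k + m + 1)"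
  by (induction m) (simp_all add: algebra_simps)

text \<open>
  A chain that is pulled towards \<open>1/2\<close> on the left and still rests at \<open>0\<close> on the right cannot be
  near equilibrium.  Let \<open>k0\<close> be the last site with \<open>y k0 \<ge> 1/2\<close> (or the left end, if there is none).
  To its right the well pulls with force \<open>- \<theta>\<^sup>2 \<bar>y\<bar>\<close>.  Pairing the forces there with a nonnegative
  weight \<open>w\<close> that satisfies \<open>\<bar>w'' \<bar> \<le> \<theta>\<^sup>2 w\<close> and moving the Laplacian onto \<open>w\<close>, the well outweighs
  every interior term, whatever the values of \<open>y\<close>.  What remains is the boundary term at \<open>k0\<close>,
  which is at most \<open>- (w 1 - w 0) / 2 \<le> - \<theta> / 4\<close>.  Cauchy-Schwarz and \<open>\<Sum> w\<^sup>2 \<le> 12 / \<theta>\<close> turn this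
  into a bound on the Euclidean norm.
\<close>

lemma chain_force_lower_bound:
  fixes y :: "nat \<Rightarrow> real"
  assumes \<theta>: "0 < \<theta>" "\<theta> \<le> 1" and "T \<ge> 1"
    and start: "y 0 = (1 - \<theta>) * y 1 + \<theta> / 2" and fin: "y T = 0" "y (Suc T) = 0"
  shows "\<theta> ^ 3 / 192 \<le> (\<Sum>k=1..T. (2 * y k - y (k - 1) - y (k + 1) + \<theta>\<^sup>2 * well_slope (y k))\<^sup>2)"
proof -
  define v where "v = (\<lambda>k. 2 * y k - y (k - 1) - y (k + 1) + \<theta>\<^sup>2 * well_slope (y k))"
  define S where "S = {k. k = 0 \<or> (k \<le> T \<and> y k \<ge> 1/2)}"
  define k0 where "k0 = Max S"
  have S: "finite S" "S \<noteq> {}"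
    by (auto simp: S_def intro: finite_subset[of _ "{..T}"])
  have k0S: "k0 \<in> S" unfolding k0_def by (rule Max_in[OF S])
  have low: "y k < 1/2" if "k0 < k" "k \<le> T" for k
    using that Max_ge[OF S(1), of k] unfolding k0_def S_def by fastforce
  have "k0 \<noteq> T" using k0S fin \<open>T \<ge> 1\<close> by (auto simp: S_def)
  then have "k0 < T" using k0S by (auto simp: S_def)
  define m where "m = T - k0"
  have m: "m \<ge> 1" "k0 + m = T" using \<open>k0 < T\<close> by (auto simp: m_def)
  let ?w = "weight \<theta>"
  have wpos: "0 \<le> ?w j" for j using weight_nonneg \<theta> by simp
  have boundary: "?w 0 * y (k0 + 1) - ?w 1 * y k0 \<le> - (?w 1 - ?w 0) / 2"
  proof (cases "k0 = 0")
    case True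
    \<comment> \<open>No site has passed 1/2, and \<open>y 0\<close> is a ghost value that encodes the weak spring at
        the left end. The spring constant \<open>\<theta>\<close> dominates the slope of the weight, so the coefficient
        of \<open>y 1\<close> is nonnegative and \<open>y 1 \<le> 1/2\<close> is the worst case.\<close>
    have y1: "y 1 \<le> 1/2" using low[of 1] True \<open>T \<ge> 1\<close> by simp
    have "0 \<le> \<theta> * ?w 1 - (?w 1 - ?w 0)" using weight_first_difference[OF \<theta>] by simp
    then have "(\<theta> * ?w 1 - (?w 1 - ?w 0)) * y 1 \<le> (\<theta> * ?w 1 - (?w 1 - ?w 0)) * (1/2)"
      using y1 by (rule mult_left_mono[rotated])
    moreover have "?w 1 * y 0 = ?w 1 * ((1 - \<theta>) * y 1 + \<theta> / 2)" by (simp only: start)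
    ultimately show ?thesis unfolding True by (simp add: algebra_simps)
  next
    case False
    then have "y k0 \<ge> 1/2" using k0S by (simp add: S_def)
    moreover have "y (k0 + 1) \<le> 1/2" using low[of "k0 + 1"] \<open>k0 < T\<close> by simp
    ultimately have "?w 0 * y (k0 + 1) \<le> ?w 0 * (1/2)" "?w 1 * (1/2) \<le> ?w 1 * y k0"
      using wpos by (intro mult_left_mono; simp)+
    then show ?thesis by simp
  qed
  have "(\<Sum>j=1..m. ?w j * v (k0 + j))
      = (\<Sum>j=1..m. ?w j * (2 * y (k0 + j) - y (k0 + j - 1) - y (k0 + j + 1)))
        + (\<Sum>j=1..m. ?w j * (\<theta>\<^sup>2 * well_slope (y (k0 + j))))"
    unfolding v_def by (simp add: sum.distrib[symmetric] algebra_simps)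
  also have "\<dots> = (\<Sum>j=1..m. y (k0 + j) * (2 * ?w j - ?w (j - 1) - ?w (j + 1))
        + ?w j * (\<theta>\<^sup>2 * well_slope (y (k0 + j)))) + (?w 0 * y (k0 + 1) - ?w 1 * y k0)"
    unfolding second_difference_by_parts using m fin by (simp add: sum.distrib)
  also have "\<dots> \<le> 0 + - (?w 1 - ?w 0) / 2"
  proof (intro add_mono sum_nonpos boundary)
    fix j assume j: "j \<in> {1..m}"
    then obtain i where i: "j = Suc i" by (cases j) auto
    have "y (k0 + j) \<le> 1/2" using low[of "k0 + j"] j m by simp
    then have ws: "well_slope (y (k0 + j)) = - \<bar>y (k0 + j)\<bar>" by (rule well_slope_below_half)
    have "y (k0 + j) * (2 * ?w j - ?w (j - 1) - ?w (j + 1))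
        \<le> \<bar>y (k0 + j)\<bar> * \<bar>2 * ?w j - ?w (j - 1) - ?w (j + 1)\<bar>"
      by (metis abs_ge_self abs_mult)
    also have "\<dots> \<le> \<bar>y (k0 + j)\<bar> * (\<theta>\<^sup>2 * ?w j)"
      using weight_second_difference[of \<theta> i] \<theta> unfolding i
      by (intro mult_left_mono) (auto simp: abs_le_iff)
    finally show "y (k0 + j) * (2 * ?w j - ?w (j - 1) - ?w (j + 1))
        + ?w j * (\<theta>\<^sup>2 * well_slope (y (k0 + j))) \<le> 0"
      unfolding ws by (simp add: algebra_simps)
  qed
  finally have "(\<Sum>j=1..m. ?w j * v (k0 + j)) \<le> - (\<theta> / 4)"
    using weight_first_difference[OF \<theta>] by simp
  then have "(\<theta> / 4)\<^sup>2 \<le> (\<Sum>j=1..m. ?w j * v (k0 + j))\<^sup>2"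
    using \<theta> power_mono[of "\<theta> / 4" "- (\<Sum>j=1..m. ?w j * v (k0 + j))" 2] by simp
  also have "\<dots> \<le> (\<Sum>j=1..m. (?w j)\<^sup>2) * (\<Sum>j=1..m. (v (k0 + j))\<^sup>2)"
    by (rule Cauchy_Schwarz_ineq_sum)
  also have "\<dots> \<le> 12 / \<theta> * (\<Sum>j=1..m. (v (k0 + j))\<^sup>2)"
    by (intro mult_right_mono sum_weight_square \<theta> sum_nonneg) auto
  also have "(\<Sum>j=1..m. (v (k0 + j))\<^sup>2) = (\<Sum>k=k0+1..T. (v k)\<^sup>2)"
    using m(2) sum.shift_bounds_cl_nat_ivl[of "\<lambda>k. (v k)\<^sup>2" 1 k0 m] by (simp add: add.commute)
  also have "\<dots> \<le> (\<Sum>k=1..T. (v k)\<^sup>2)"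
    by (intro sum_mono2) auto
  finally have "(\<theta> / 4)\<^sup>2 \<le> 12 / \<theta> * (\<Sum>k=1..T. (v k)\<^sup>2)" 
    using \<theta> by (simp add: mult_left_mono divide_right_mono)
  then have "\<theta> ^ 3 / 192 \<le> (\<Sum>k=1..T. (v k)\<^sup>2)"
    using \<theta> by (simp add: field_simps power2_eq_square power3_eq_cube)
  then show ?thesis unfolding v_def .
qed

section \<open>Orthonormal families and smoothness in the coordinate spaces\<close>

text \<open>
  The algorithm may use multiples of its starting point for free, so the hard functions have to ignore
  that direction.  The Householder reflection along \<open>w = x - \<parallel>x\<parallel> e\<^sub>m\<close> maps \<open>x\<close> to
  \<open>\<parallel>x\<parallel> e\<^sub>m\<close>, and hence maps \<open>e\<^sub>0, \<dots>, e\<^bsub>m-1\<^esub>\<close> to an orthonormal family that is orthogonal to \<open>x\<close>.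
  For \<open>w = 0\<close> division by zero makes the formula the identity, as it should be.
\<close>

lemma orthonormal_family_orthogonal_to:
  assumes x: "x \<in> Rn (Suc m)"
  obtains e :: "nat \<Rightarrow> rvec" where "\<And>k. k < m \<Longrightarrow> e k \<in> Rn (Suc m)"
    "\<And>k. k < m \<Longrightarrow> inner (e k) x = 0"
    "\<And>j k. j < m \<Longrightarrow> k < m \<Longrightarrow> inner (e j) (e k) = (if j = k then 1 else 0)"
proof -
  have bR: "basis k \<in> Rn (Suc m)" if "k \<le> m" for k using that by (auto simp: Rn_def)
  have bb: "inner (basis j) (basis k) = (if j = k then 1 else 0)" if "j \<le> m" for j k
  proof -
    have "inner (basis j) (basis k) = (\<Sum>l<Suc m. if l = j then (if j = k then 1 else 0) else 0)"
      unfolding inner_Rn[OF bR[OF that]] by (intro sum.cong) auto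
    then show ?thesis using that by simp
  qed
  define w where "w = x - norm x *\<^sub>R basis m"
  define e where "e = (\<lambda>k. basis k - (2 * inner w (basis k) / inner w w) *\<^sub>R w)"
  have wR: "w \<in> Rn (Suc m)" unfolding w_def using x bR[of m]
    by (intro subspace_diff subspace_scale subspace_Rn) auto
  have wb: "inner w (basis k) = inner x (basis k)" if "k < m" for k
    using that bb[of m k] by (simp add: w_def inner_diff_left)
  have ww: "inner w w = 2 * inner w x"
  proof -
    have xx: "inner x x = norm x * norm x" by (simp add: dot_square_norm power2_eq_square)
    have "inner w (basis m) = inner x (basis m) - norm x"
      using bb[of m m] by (simp add: w_def inner_diff_left)
    moreover have "inner w x = norm x * norm x - norm x * inner x (basis m)"
      by (simp add: w_def inner_diff_left xx inner_commute[of "basis m" x])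
    moreover have "inner w w = inner w x - norm x * inner w (basis m)"
      by (simp add: w_def inner_diff_right)
    ultimately show ?thesis by (simp add: right_diff_distrib)
  qed
  show thesis
  proof (rule that[of e])
    fix k assume k: "k < m"
    show "e k \<in> Rn (Suc m)" unfolding e_def using wR bR[of k] k
      by (intro subspace_diff subspace_scale subspace_Rn) auto
    show "inner (e k) x = 0"
    proof (cases "w = 0")
      case True
      then show ?thesis using wb[OF k] by (simp add: e_def inner_commute[of x])
    next
      case False
      then have "inner w x \<noteq> 0" using ww by auto
      moreover have "inner (basis k) x = inner w (basis k)"
        using wb[OF k] by (simp add: inner_commute)
      ultimately show ?thesis using ww by (simp add: e_def inner_diff_left)
    qed
  next
    fix j k assume jk: "j < m" "k < m"
    show "inner (e j) (e k) = (if j = k then 1 else 0)"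
    proof (cases "w = 0")
      case True
      then show ?thesis using bb[of j k] jk by (simp add: e_def)
    next
      case False
      then have "inner w w \<noteq> 0" by simp
      then have "inner (e j) (e k) = inner (basis j) (basis k)"
        by (simp add: e_def inner_diff_left inner_diff_right inner_commute[of "basis j" w])
      then show ?thesis using bb[of j k] jk by simp
    qed
  qed
qed

lemma
  fixes u :: "'i \<Rightarrow> 'a::real_inner"
  assumes I: "finite I"
    and orth: "\<And>p q. p \<in> I \<Longrightarrow> q \<in> I \<Longrightarrow> inner (u p) (u q) = (if p = q then 1 else 0)"
  shows inner_orthonormal_sum: "q \<in> I \<Longrightarrow> inner (u q) (\<Sum>p\<in>I. c p *\<^sub>R u p) = c q"
    and norm_orthonormal_sum: "(norm (\<Sum>p\<in>I. c p *\<^sub>R u p))\<^sup>2 = (\<Sum>p\<in>I. (c p)\<^sup>2)"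
    and bessel: "(\<Sum>p\<in>I. (inner (u p) x)\<^sup>2) \<le> (norm x)\<^sup>2"
proof -
  have *: "inner (u q) (\<Sum>p\<in>I. c p *\<^sub>R u p) = c q" if "q \<in> I" for q c
  proof -
    have "inner (u q) (\<Sum>p\<in>I. c p *\<^sub>R u p) = (\<Sum>p\<in>I. if q = p then c p else 0)"
      unfolding inner_sum_right using orth that by (intro sum.cong) auto
    then show ?thesis using I that by simp
  qed
  have sq: "(norm (\<Sum>p\<in>I. c p *\<^sub>R u p))\<^sup>2 = (\<Sum>p\<in>I. (c p)\<^sup>2)" for c
    unfolding power2_norm_eq_inner
    by (subst inner_sum_left, intro sum.cong refl) (simp add: * power2_eq_square)
  show "q \<in> I \<Longrightarrow> inner (u q) (\<Sum>p\<in>I. c p *\<^sub>R u p) = c q" by (rule *)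
  show "(norm (\<Sum>p\<in>I. c p *\<^sub>R u p))\<^sup>2 = (\<Sum>p\<in>I. (c p)\<^sup>2)" by (rule sq)
  define P where "P = (\<Sum>p\<in>I. inner (u p) x *\<^sub>R u p)"
  have "inner P x = (\<Sum>p\<in>I. (inner (u p) x)\<^sup>2)"
    by (simp add: P_def inner_sum_left power2_eq_square)
  moreover have "inner P P = (\<Sum>p\<in>I. (inner (u p) x)\<^sup>2)"
    using sq[of "\<lambda>p. inner (u p) x"] by (simp add: P_def power2_norm_eq_inner)
  moreover have "0 \<le> inner (x - P) (x - P)" by simp
  ultimately show "(\<Sum>p\<in>I. (inner (u p) x)\<^sup>2) \<le> (norm x)\<^sup>2"
    by (simp add: power2_norm_eq_inner inner_diff_left inner_diff_right inner_commute[of x P])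
qed

lemma has_derivative_quadratic_remainder:
  fixes f :: "rvec \<Rightarrow> real"
  assumes y: "y \<in> S" and b: "\<And>x. x \<in> S \<Longrightarrow> \<bar>f x - f y - inner g (x - y)\<bar> \<le> C * (norm (x - y))\<^sup>2"
  shows "(f has_derivative (\<lambda>h. inner g h)) (at y within S)"
  unfolding has_derivative_within
proof
  show "bounded_linear (\<lambda>h. inner g h)" by (rule bounded_linear_inner_right)
  show "((\<lambda>x. (1 / norm (x - y)) *\<^sub>R (f x - (f y + inner g (x - y)))) \<longlongrightarrow> 0) (at y within S)"
  proof (rule Lim_null_comparison)
    show "\<forall>\<^sub>F x in at y within S.
        norm ((1 / norm (x - y)) *\<^sub>R (f x - (f y + inner g (x - y)))) \<le> C * norm (x - y)"
      unfolding eventually_at_filter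
    proof (intro always_eventually allI impI)
      fix x assume "x \<noteq> y" "x \<in> S"
      then show "norm ((1 / norm (x - y)) *\<^sub>R (f x - (f y + inner g (x - y)))) \<le> C * norm (x - y)"
        using b[of x] by (simp add: field_simps power2_eq_square)
    qed
    have "((\<lambda>x. C * norm (x - y)) \<longlongrightarrow> C * norm (y - y)) (at y within S)"
      by (intro tendsto_intros)
    then show "((\<lambda>x. C * norm (x - y)) \<longlongrightarrow> 0) (at y within S)" by simp
  qed
qed

text \<open>
  A two-sided quadratic bound on the linearisation error already forces differentiability, with the
  given linear part as gradient.  So neither the wells nor the chains need to be differentiated.
\<close>

lemma quadratic_bounds_smooth:
  assumes g: "\<And>y. y \<in> Rn d \<Longrightarrow> g y \<in> Rn d"
    and b: "\<And>x y. x \<in> Rn d \<Longrightarrow> y \<in> Rn d \<Longrightarrow>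
       l / 2 * (norm (x - y))\<^sup>2 \<le> f x - f y - inner (g y) (x - y) \<and>
       f x - f y - inner (g y) (x - y) \<le> L / 2 * (norm (x - y))\<^sup>2"
  shows "f \<in> smooth_class d l L" "\<And>y. y \<in> Rn d \<Longrightarrow> gradient d f y = g y"
proof -
  have D: "(f has_derivative (\<lambda>h. inner (g y) h)) (at y within Rn d)" if y: "y \<in> Rn d" for y
  proof (rule has_derivative_quadratic_remainder[OF y])
    fix x assume x: "x \<in> Rn d"
    have "l / 2 * (norm (x - y))\<^sup>2 \<ge> - (max \<bar>l\<bar> \<bar>L\<bar> / 2) * (norm (x - y))\<^sup>2"
      "L / 2 * (norm (x - y))\<^sup>2 \<le> max \<bar>l\<bar> \<bar>L\<bar> / 2 * (norm (x - y))\<^sup>2"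
      by (intro mult_right_mono; simp)+
    then show "\<bar>f x - f y - inner (g y) (x - y)\<bar> \<le> max \<bar>l\<bar> \<bar>L\<bar> / 2 * (norm (x - y))\<^sup>2"
      using b[OF x y] by (intro abs_leI) auto
  qed
  show G: "gradient d f y = g y" if y: "y \<in> Rn d" for y
    by (rule gradient_eqI[OF y g[OF y] D[OF y]])
  show "f \<in> smooth_class d l L"
    unfolding smooth_class_def differentiable_on_def differentiable_def
    using D b G by auto
qed

lemma smooth_class_mono:
  assumes "l' \<le> l" "L \<le> L'"
  shows "smooth_class d l L \<subseteq> smooth_class d l' L'"
proof -
  have "l' / 2 * r\<^sup>2 \<le> l / 2 * r\<^sup>2" "L / 2 * r\<^sup>2 \<le> L' / 2 * r\<^sup>2" for r :: real
    using assms by (intro mult_right_mono; simp)+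
  then show ?thesis unfolding smooth_class_def by (blast intro: order_trans)
qed

section \<open>The energy of a chain\<close>

text \<open>
  Two ghost sites let all sites of a chain be treated alike.  The value at site \<open>0\<close> is chosen so
  that the unit spring to it exerts the force \<open>\<theta> (y 1 - 1/2)\<close> of a weak spring to \<open>1/2\<close>; the
  value at site \<open>T + 1\<close> copies site \<open>T\<close>, which makes the right end free.
\<close>

definition ghost :: "nat \<Rightarrow> real \<Rightarrow> (nat \<Rightarrow> real) \<Rightarrow> nat \<Rightarrow> real" where
  "ghost T \<theta> y k = (if k = 0 then (1 - \<theta>) * y 1 + \<theta> / 2 else if k \<le> T then y k else y T)"

text \<open>
  The gradient of \<open>chain\<close>, see \<open>chain_expansion\<close>.
\<close>

definition tension :: "nat \<Rightarrow> real \<Rightarrow> (nat \<Rightarrow> real) \<Rightarrow> nat \<Rightarrow> real" where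
  "tension T \<theta> y k = 2 * ghost T \<theta> y k - ghost T \<theta> y (k - 1) - ghost T \<theta> y (k + 1)"

text \<open>
  The spring at site \<open>1\<close> has strength \<open>\<theta>\<close> instead of \<open>1\<close>, and its rest position is \<open>1/2\<close>.  This
  keeps the energy of the chain at rest in \<open>0\<close> as small as \<open>\<theta> / 8\<close>, of the order of the
  well energy of \<open>1 / \<theta>\<close> sites, while the spring is still strong enough to set the chain in motion.
\<close>

definition chain :: "nat \<Rightarrow> real \<Rightarrow> (nat \<Rightarrow> real) \<Rightarrow> real" where
  "chain T \<theta> y = \<theta> / 2 * (y 1 - 1/2)\<^sup>2 + (\<Sum>k=1..<T. (y k - y (Suc k))\<^sup>2) / 2"

lemma sum_differences_by_parts:
  fixes D e :: "nat \<Rightarrow> real"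
  assumes "T \<ge> 1"
  shows "(\<Sum>k=1..T. (D k - D (k - 1)) * e k)
    = - D 0 * e 1 + (\<Sum>k=1..<T. D k * (e k - e (Suc k))) + D T * e T"
  using assms by (induction T rule: dec_induct) (simp_all add: algebra_simps)

lemma sum_tension:
  assumes "T \<ge> 1"
  shows "(\<Sum>k=1..T. tension T \<theta> y k * e k)
    = \<theta> * (y 1 - 1/2) * e 1 + (\<Sum>k=1..<T. (y k - y (Suc k)) * (e k - e (Suc k)))"
proof -
  define D where "D = (\<lambda>k. ghost T \<theta> y k - ghost T \<theta> y (Suc k))"
  have "(\<Sum>k=1..T. tension T \<theta> y k * e k) = (\<Sum>k=1..T. (D k - D (k - 1)) * e k)"
    by (intro sum.cong) (auto simp: tension_def D_def)
  also have "\<dots> = - D 0 * e 1 + (\<Sum>k=1..<T. D k * (e k - e (Suc k))) + D T * e T"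
    by (rule sum_differences_by_parts[OF assms])
  also have "D 0 = - \<theta> * (y 1 - 1/2)"
    using assms by (simp add: D_def ghost_def algebra_simps)
  also have "D T = 0"
    using assms by (simp add: D_def ghost_def)
  also have "(\<Sum>k=1..<T. D k * (e k - e (Suc k))) = (\<Sum>k=1..<T. (y k - y (Suc k)) * (e k - e (Suc k)))"
    by (intro sum.cong) (auto simp: D_def ghost_def)
  finally show ?thesis by simp
qed

lemma chain_nonneg: "0 \<le> \<theta> \<Longrightarrow> 0 \<le> chain T \<theta> y"
  unfolding chain_def by (intro add_nonneg_nonneg mult_nonneg_nonneg divide_nonneg_nonneg sum_nonneg) auto

text \<open>
  A quadratic function equals its linearisation plus its quadratic form.
\<close>

lemma chain_expansion:
  assumes "T \<ge> 1"
  shows "chain T \<theta> x - chain T \<theta> y - (\<Sum>k=1..T. tension T \<theta> y k * (x k - y k))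
    = \<theta> / 2 * (x 1 - y 1)\<^sup>2 + (\<Sum>k=1..<T. ((x k - y k) - (x (Suc k) - y (Suc k)))\<^sup>2) / 2"
proof -
  have "(\<Sum>k=1..<T. (x k - x (Suc k))\<^sup>2)
    = (\<Sum>k=1..<T. (y k - y (Suc k))\<^sup>2)
      + 2 * (\<Sum>k=1..<T. (y k - y (Suc k)) * ((x k - y k) - (x (Suc k) - y (Suc k))))
      + (\<Sum>k=1..<T. ((x k - y k) - (x (Suc k) - y (Suc k)))\<^sup>2)"
    unfolding sum_distrib_left sum.distrib[symmetric]
    by (intro sum.cong) (auto simp: power2_eq_square algebra_simps)
  moreover have "\<theta> / 2 * (x 1 - 1/2)\<^sup>2 = \<theta> / 2 * (y 1 - 1/2)\<^sup>2 + \<theta> * (y 1 - 1/2) * (x 1 - y 1)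
      + \<theta> / 2 * (x 1 - y 1)\<^sup>2"
    by (simp add: power2_eq_square field_simps)
  ultimately show ?thesis unfolding sum_tension[OF assms] chain_def by (simp add: field_simps)
qed

lemma chain_form_le:
  fixes e :: "nat \<Rightarrow> real"
  assumes "T \<ge> 1" "\<theta> \<le> 1"
  shows "\<theta> / 2 * (e 1)\<^sup>2 + (\<Sum>k=1..<T. (e k - e (Suc k))\<^sup>2) / 2 \<le> 2 * (\<Sum>k=1..T. (e k)\<^sup>2)"
proof -
  have "\<theta> / 2 * (e 1)\<^sup>2 + (\<Sum>k=1..<T. (e k - e (Suc k))\<^sup>2) / 2 \<le> 2 * (\<Sum>k=1..T. (e k)\<^sup>2) - (e T)\<^sup>2"
    using assms(1)
    \<comment> \<open>Subtracting the last square leaves room for the next spring.\<close>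
  proof (induction T rule: dec_induct)
    case base
    then show ?case using mult_right_mono[of "\<theta> / 2" 1 "(e 1)\<^sup>2"] assms(2) by simp
  next
    case (step m)
    have "(e m - e (Suc m))\<^sup>2 / 2 \<le> (e m)\<^sup>2 + (e (Suc m))\<^sup>2"
      using zero_le_power2[of "e m + e (Suc m)"] by (simp add: power2_eq_square field_simps)
    then show ?case using step by (simp add: add_divide_distrib)
  qed
  then show ?thesis using zero_le_power2[of "e T"] by linarith
qed

section \<open>The hard functions\<close>

text \<open>
  A site \<open>(i, k)\<close> is the \<open>k\<close>-th position, \<open>1 \<le> k \<le> T\<close>, in the chain of component \<open>i\<close>; \<open>u (i, k)\<close> is its
  direction in space.  \<open>K\<close> scales the springs, \<open>K \<theta>\<^sup>2\<close> the wells of the average, and \<open>lam\<close> scales the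
  argument, which changes gradients by \<open>lam\<close> and values by \<open>lam\<^sup>2\<close> but no curvature.
\<close>

locale hard_instance =
  fixes n T d :: nat and u :: "nat \<times> nat \<Rightarrow> rvec" and lam K \<theta> :: real
  assumes n: "n \<ge> 1" and T: "T \<ge> 1"
    and lam: "lam > 0" and K: "K > 0" and \<theta>: "0 < \<theta>" "\<theta> \<le> 1"
    and u_Rn: "p \<in> {1..n} \<times> {1..T} \<Longrightarrow> u p \<in> Rn d"
    and u_orthonormal: "p \<in> {1..n} \<times> {1..T} \<Longrightarrow> q \<in> {1..n} \<times> {1..T} \<Longrightarrow>
      inner (u p) (u q) = (if p = q then 1 else 0)"
begin

abbreviation sites :: "(nat \<times> nat) set" where "sites \<equiv> {1..n} \<times> {1..T}"

definition site :: "rvec \<Rightarrow> nat \<times> nat \<Rightarrow> real" where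
  "site x p = inner (u p) x / lam"

text \<open>
  The springs of chain \<open>i\<close> occur in component \<open>i\<close> only, but the wells of all chains are shared equally
  among the components.  Sharing divides the negative curvature of each component by \<open>n\<close> and leaves
  that of the average as seen by one chain unchanged: this is the source of the factor \<open>\<surd>n\<close>.
\<close>

definition component :: "nat \<Rightarrow> rvec \<Rightarrow> real" where
  "component i x = lam\<^sup>2 * K * (chain T \<theta> (\<lambda>k. site x (i, k))
     + \<theta>\<^sup>2 / real n * (\<Sum>p\<in>sites. well (site x p)))"

definition force :: "nat \<Rightarrow> rvec \<Rightarrow> nat \<times> nat \<Rightarrow> real" where
  "force i x p = (if fst p = i then tension T \<theta> (\<lambda>k. site x (i, k)) (snd p) else 0)
     + \<theta>\<^sup>2 / real n * well_slope (site x p)"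

definition component_gradient :: "nat \<Rightarrow> rvec \<Rightarrow> rvec" where
  "component_gradient i x = (\<Sum>p\<in>sites. (lam * K * force i x p) *\<^sub>R u p)"

lemma sum_block:
  assumes "i \<in> {1..n}"
  shows "(\<Sum>p\<in>sites. if fst p = i then g (snd p) else 0) = (\<Sum>k=1..T. g k :: real)"
proof -
  have "(\<Sum>p\<in>sites. if fst p = i then g (snd p) else 0)
      = (\<Sum>j=1..n. \<Sum>k=1..T. if j = i then g k else 0)"
    by (simp add: sum.cartesian_product case_prod_unfold)
  also have "\<dots> = (\<Sum>j=1..n. if j = i then (\<Sum>k=1..T. g k) else 0)"
    by (intro sum.cong) auto
  also have "\<dots> = (\<Sum>k=1..T. g k)" using assms by simp
  finally show ?thesis .
qed

lemma component_gradient_Rn: "component_gradient i x \<in> Rn d"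
  unfolding component_gradient_def
  by (intro subspace_sum subspace_scale subspace_Rn u_Rn)

lemma component_nonneg: "0 \<le> component i x"
  unfolding component_def using lam K \<theta>
  by (intro mult_nonneg_nonneg add_nonneg_nonneg chain_nonneg sum_nonneg well_nonneg) auto

lemma lam_site_diff: "lam * (site x p - site y p) = inner (u p) (x - y)"
  using lam by (simp add: site_def inner_diff_right flip: diff_divide_distrib)

lemma sum_site_square: "lam\<^sup>2 * (\<Sum>p\<in>sites. (site x p - site y p)\<^sup>2) \<le> (norm (x - y))\<^sup>2"
proof -
  have "lam\<^sup>2 * (\<Sum>p\<in>sites. (site x p - site y p)\<^sup>2) = (\<Sum>p\<in>sites. (inner (u p) (x - y))\<^sup>2)"
    unfolding sum_distrib_left by (simp add: power_mult_distrib flip: lam_site_diff)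
  also have "\<dots> \<le> (norm (x - y))\<^sup>2" by (intro bessel u_orthonormal) auto
  finally show ?thesis .
qed

text \<open>
  The linearisation error splits into the nonnegative quadratic form of the springs and the errors of
  the wells.  By Bessel's inequality, the squared site displacements sum to at most
  \<open>\<parallel>x - y\<parallel>\<^sup>2 / lam\<^sup>2\<close>.
\<close>

lemma component_bounds:
  assumes i: "i \<in> {1..n}"
  shows "- (K * \<theta>\<^sup>2 / real n) / 2 * (norm (x - y))\<^sup>2
      \<le> component i x - component i y - inner (component_gradient i y) (x - y)"
    and "component i x - component i y - inner (component_gradient i y) (x - y)
      \<le> (5 * K) / 2 * (norm (x - y))\<^sup>2"
proof -
  define e where "e = (\<lambda>p. site x p - site y p)"
  define q where "q = \<theta> / 2 * (e (i, 1))\<^sup>2 + (\<Sum>k=1..<T. (e (i, k) - e (i, Suc k))\<^sup>2) / 2"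
  define b where "b = (\<Sum>p\<in>sites. well (site x p) - well (site y p) - well_slope (site y p) * e p)"
  define E where "E = (\<Sum>p\<in>sites. (e p)\<^sup>2)"
  have "inner (component_gradient i y) (x - y) = (\<Sum>p\<in>sites. lam * K * force i y p * (lam * e p))"
    unfolding component_gradient_def inner_sum_left e_def by (simp add: lam_site_diff)
  also have "\<dots> = lam\<^sup>2 * K * (\<Sum>p\<in>sites. force i y p * e p)"
    by (simp add: sum_distrib_left power2_eq_square algebra_simps)
  also have "(\<Sum>p\<in>sites. force i y p * e p)
      = (\<Sum>p\<in>sites. if fst p = i then tension T \<theta> (\<lambda>k. site y (i, k)) (snd p) * e (i, snd p) else 0)
        + \<theta>\<^sup>2 / real n * (\<Sum>p\<in>sites. well_slope (site y p) * e p)"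
    unfolding sum_distrib_left sum.distrib[symmetric] force_def
    by (intro sum.cong) (auto simp: algebra_simps)
  also have "(\<Sum>p\<in>sites. if fst p = i then tension T \<theta> (\<lambda>k. site y (i, k)) (snd p) * e (i, snd p) else 0)
      = (\<Sum>k=1..T. tension T \<theta> (\<lambda>k. site y (i, k)) k * (site x (i, k) - site y (i, k)))"
    using sum_block[OF i, of "\<lambda>k. tension T \<theta> (\<lambda>k. site y (i, k)) k * e (i, k)"]
    by (simp add: e_def)
  finally have g: "inner (component_gradient i y) (x - y) = lam\<^sup>2 * K *
      ((\<Sum>k=1..T. tension T \<theta> (\<lambda>k. site y (i, k)) k * (site x (i, k) - site y (i, k)))
        + \<theta>\<^sup>2 / real n * (\<Sum>p\<in>sites. well_slope (site y p) * e p))" .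
  have ring: "P * (a + q * b) - P * (a' + q * b') - P * (t + q * s) = P * ((a - a' - t) + q * (b - b' - s))"
    for P q a b a' b' s t :: real by (simp add: algebra_simps)
  have "component i x - component i y - inner (component_gradient i y) (x - y)
      = lam\<^sup>2 * K * ((chain T \<theta> (\<lambda>k. site x (i, k)) - chain T \<theta> (\<lambda>k. site y (i, k))
          - (\<Sum>k=1..T. tension T \<theta> (\<lambda>k. site y (i, k)) k * (site x (i, k) - site y (i, k))))
        + \<theta>\<^sup>2 / real n * b)"
    unfolding component_def b_def sum_subtractf unfolding g by (rule ring)
  then have eq: "component i x - component i y - inner (component_gradient i y) (x - y)
      = lam\<^sup>2 * K * (q + \<theta>\<^sup>2 / real n * b)"
    unfolding chain_expansion[OF T] q_def e_def .
  have w: "- ((e p)\<^sup>2 / 2) \<le> well (site x p) - well (site y p) - well_slope (site y p) * e p"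
    "well (site x p) - well (site y p) - well_slope (site y p) * e p \<le> (e p)\<^sup>2 / 2" for p
    using well_quadratic_bound[of "site x p" "site y p"] unfolding e_def abs_le_iff by linarith+
  have b: "- (E / 2) \<le> b" "b \<le> E / 2"
    unfolding b_def E_def sum_divide_distrib sum_negf[symmetric] by (intro sum_mono w)+
  have q: "0 \<le> q" "q \<le> 2 * E"
  proof -
    show "0 \<le> q" unfolding q_def using \<theta>
      by (intro add_nonneg_nonneg mult_nonneg_nonneg divide_nonneg_nonneg sum_nonneg) auto
    have "q \<le> 2 * (\<Sum>k=1..T. (e (i, k))\<^sup>2)"
      unfolding q_def by (rule chain_form_le[OF T \<theta>(2)])
    also have "(\<Sum>k=1..T. (e (i, k))\<^sup>2) = (\<Sum>p\<in>sites. if fst p = i then (e (i, snd p))\<^sup>2 else 0)"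
      by (rule sum_block[OF i, symmetric])
    also have "\<dots> \<le> E" unfolding E_def by (intro sum_mono) auto
    finally show "q \<le> 2 * E" by simp
  qed
  have E: "0 \<le> E" "lam\<^sup>2 * E \<le> (norm (x - y))\<^sup>2"
    using sum_site_square[of x y] by (auto simp: E_def e_def intro: sum_nonneg)
  have c: "0 \<le> \<theta>\<^sup>2 / real n" "\<theta>\<^sup>2 / real n \<le> 1"
    using \<theta> n power_le_one[of \<theta> 2] by (auto simp: divide_le_eq)
  have "- (K * \<theta>\<^sup>2 / real n) / 2 * (norm (x - y))\<^sup>2 \<le> - (K * \<theta>\<^sup>2 / real n) / 2 * (lam\<^sup>2 * E)"
    using E K by (intro mult_left_mono_neg) auto
  also have "\<dots> = lam\<^sup>2 * K * (0 + \<theta>\<^sup>2 / real n * - (E / 2))" by simp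
  also have "\<dots> \<le> lam\<^sup>2 * K * (q + \<theta>\<^sup>2 / real n * b)"
    using K b q c by (intro mult_left_mono add_mono) auto
  finally show "- (K * \<theta>\<^sup>2 / real n) / 2 * (norm (x - y))\<^sup>2
      \<le> component i x - component i y - inner (component_gradient i y) (x - y)" unfolding eq .
  have "\<theta>\<^sup>2 / real n * b \<le> \<theta>\<^sup>2 / real n * (E / 2)" using c b by (intro mult_left_mono) auto
  also have "\<dots> \<le> 1 * (E / 2)" using c E by (intro mult_right_mono) auto
  finally have "q + \<theta>\<^sup>2 / real n * b \<le> 5 / 2 * E" using q by linarith
  then have "lam\<^sup>2 * K * (q + \<theta>\<^sup>2 / real n * b) \<le> lam\<^sup>2 * K * (5 / 2 * E)"
    using K by (intro mult_left_mono) auto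
  also have "\<dots> = 5 * K / 2 * (lam\<^sup>2 * E)" by simp
  also have "\<dots> \<le> (5 * K) / 2 * (norm (x - y))\<^sup>2" using E K by (intro mult_left_mono) auto
  finally show "component i x - component i y - inner (component_gradient i y) (x - y)
      \<le> (5 * K) / 2 * (norm (x - y))\<^sup>2" unfolding eq .
qed

lemma component_smooth:
  assumes "i \<in> {1..n}"
  shows "component i \<in> smooth_class d (- (K * \<theta>\<^sup>2 / real n)) (5 * K)"
    and "x \<in> Rn d \<Longrightarrow> gradient d (component i) x = component_gradient i x"
proof -
  have R: "component_gradient i y \<in> Rn d" for y by (rule component_gradient_Rn)
  have B: "- (K * \<theta>\<^sup>2 / real n) / 2 * (norm (x - y))\<^sup>2
        \<le> component i x - component i y - inner (component_gradient i y) (x - y) \<and>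
      component i x - component i y - inner (component_gradient i y) (x - y)
        \<le> (5 * K) / 2 * (norm (x - y))\<^sup>2" for x y
    by (intro conjI component_bounds[OF assms])
  show "component i \<in> smooth_class d (- (K * \<theta>\<^sup>2 / real n)) (5 * K)"
    by (rule quadratic_bounds_smooth(1)[OF R B])
  show "x \<in> Rn d \<Longrightarrow> gradient d (component i) x = component_gradient i x"
    by (rule quadratic_bounds_smooth(2)[OF R B])
qed

text \<open>
  In the average the chains decouple: each feels its own springs, with the factor \<open>1 / n\<close>, and wells of
  the full strength \<open>\<theta>\<^sup>2\<close> relative to them.
\<close>

lemma average_gradient:
  assumes x: "x \<in> Rn d"
  shows "gradient d (average n component) x
    = (\<Sum>p\<in>sites. (lam * K / real n *
        (tension T \<theta> (\<lambda>k. site x (fst p, k)) (snd p) + \<theta>\<^sup>2 * well_slope (site x p))) *\<^sub>R u p)"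
proof -
  let ?g = "\<lambda>y. (\<Sum>i=1..n. component_gradient i y) /\<^sub>R real n"
  have "gradient d (average n component) x = ?g x"
  proof (rule quadratic_bounds_smooth(2)[OF _ _ x])
    show "?g y \<in> Rn d" for y
      by (intro subspace_scale subspace_sum subspace_Rn component_gradient_Rn)
    fix x y
    have eq: "average n component x - average n component y - inner (?g y) (x - y)
      = (\<Sum>i=1..n. component i x - component i y - inner (component_gradient i y) (x - y)) / real n"
      by (simp add: average_def sum_subtractf sum.distrib inner_sum_left divide_inverse algebra_simps)
    let ?l = "- (K * \<theta>\<^sup>2 / real n) / 2 * (norm (x - y))\<^sup>2" and ?L = "(5 * K) / 2 * (norm (x - y))\<^sup>2"
    have "(\<Sum>i=1..n. ?l) \<le> (\<Sum>i=1..n. component i x - component i y - inner (component_gradient i y) (x - y))"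
      "(\<Sum>i=1..n. component i x - component i y - inner (component_gradient i y) (x - y)) \<le> (\<Sum>i=1..n. ?L)"
      by (intro sum_mono component_bounds; assumption)+
    then show "?l \<le> average n component x - average n component y - inner (?g y) (x - y) \<and>
      average n component x - average n component y - inner (?g y) (x - y) \<le> ?L"
      unfolding eq using n by (simp add: le_divide_eq divide_le_eq mult.commute)
  qed
  also have "\<dots> = (\<Sum>p\<in>sites. (\<Sum>i=1..n. lam * K / real n * force i x p) *\<^sub>R u p)"
    unfolding component_gradient_def
    by (subst sum.swap) (simp add: scaleR_sum_right scaleR_sum_left divide_inverse mult_ac)
  also have "\<dots> = (\<Sum>p\<in>sites. (lam * K / real n *
        (tension T \<theta> (\<lambda>k. site x (fst p, k)) (snd p) + \<theta>\<^sup>2 * well_slope (site x p))) *\<^sub>R u p)"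
  proof (intro sum.cong refl)
    fix p assume p: "p \<in> sites"
    have "(\<Sum>i=1..n. force i x p) =
        (\<Sum>i=1..n. if i = fst p then tension T \<theta> (\<lambda>k. site x (fst p, k)) (snd p) else 0)
          + (\<Sum>i=1..n. \<theta>\<^sup>2 / real n * well_slope (site x p))"
      unfolding force_def sum.distrib[symmetric] by (intro sum.cong) auto
    also have "\<dots> = tension T \<theta> (\<lambda>k. site x (fst p, k)) (snd p) + \<theta>\<^sup>2 * well_slope (site x p)"
      using p n by auto
    finally show "(\<Sum>i=1..n. lam * K / real n * force i x p) *\<^sub>R u p = (lam * K / real n *
        (tension T \<theta> (\<lambda>k. site x (fst p, k)) (snd p) + \<theta>\<^sup>2 * well_slope (site x p))) *\<^sub>R u p"
      unfolding sum_distrib_left[symmetric] by simp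
  qed
  finally show ?thesis .
qed

text \<open>
  After at most \<open>c i\<close> calls to each component \<open>i\<close> the iterates are confined to this subspace.
\<close>

definition reached :: "(nat \<Rightarrow> nat) \<Rightarrow> rvec set" where
  "reached c = {x \<in> Rn d. \<forall>i\<in>{1..n}. \<forall>k\<in>{1..T}. c i < k \<longrightarrow> inner (u (i, k)) x = 0}"

lemma subspace_reached: "subspace (reached c)"
  using subspace_Rn[of d] by (auto simp: subspace_def reached_def inner_add_right)

lemma reached_mono: "(\<And>i. c i \<le> c' i) \<Longrightarrow> reached c \<subseteq> reached c'"
  unfolding reached_def by (auto dest: le_less_trans)

text \<open>
  A call to component \<open>i\<close> uncovers at most one new site: the wells have slope \<open>0\<close> at \<open>0\<close>, and the springs
  of chain \<open>i\<close> transmit a displacement only to the next site.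
\<close>

lemma component_gradient_reached:
  assumes x: "x \<in> reached c"
  shows "component_gradient i x \<in> reached (c(i := Suc (c i)))"
proof -
  have z: "site x (j, k) = 0" if "j \<in> {1..n}" "k \<in> {1..T}" "c j < k" for j k
    using x that by (auto simp: reached_def site_def)
  have f: "force i x (j, k) = 0" if jk: "j \<in> {1..n}" "k \<in> {1..T}" "(c(i := Suc (c i))) j < k" for j k
  proof -
    have "c j < k" using jk(3) by (auto split: if_splits)
    then have "well_slope (site x (j, k)) = 0"
      using z[OF jk(1,2)] by (simp add: well_slope_def)
    moreover have "tension T \<theta> (\<lambda>k. site x (i, k)) k = 0" if "j = i"
    proof -
      have "site x (i, l) = 0" if "l \<ge> k - 1" "l \<le> T" for l
        using that jk \<open>j = i\<close> by (intro z) auto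
      then show ?thesis using jk \<open>j = i\<close> by (auto simp: tension_def ghost_def)
    qed
    ultimately show ?thesis by (simp add: force_def)
  qed
  have "inner (u q) (component_gradient i x) = lam * K * force i x q" if "q \<in> sites" for q
    unfolding component_gradient_def using that
    by (intro inner_orthonormal_sum u_orthonormal) auto
  then show ?thesis using f component_gradient_Rn by (simp add: reached_def)
qed

text \<open>
  The points and gradients seen so far all lie in one subspace of the family \<open>reached\<close>, and so does
  their span.  The bound holds for every sequence of indices, so randomness and knowledge of the
  functions do not help the algorithm.
\<close>

lemma trajectory_reached:
  fixes x :: "nat \<Rightarrow> rvec" and idx :: "nat \<Rightarrow> nat"
  assumes x0: "x 0 \<in> reached (\<lambda>_. 0)"
    and idx: "\<And>t. idx t \<in> {1..n}"
    and step: "\<And>t. x (Suc t) \<in> span (x ` {..t} \<union> (\<lambda>s. gradient d (component (idx s)) (x s)) ` {..t})"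
  shows "x t \<in> reached (\<lambda>i. card {s. s < t \<and> idx s = i})"
proof (induction t rule: less_induct)
  case (less t)
  let ?c = "\<lambda>t i. card {s. s < t \<and> idx s = i}"
  show ?case
  proof (cases t)
    case 0
    then show ?thesis using x0 by simp
  next
    case (Suc r)
    have mono: "?c s i \<le> ?c t i" if "s \<le> t" for s i
      using that by (intro card_mono) auto
    have pts: "x s \<in> reached (?c t)" if "s \<le> r" for s
    proof -
      have "s < t" "s \<le> t" using that Suc by auto
      then show ?thesis
        using subsetD[OF reached_mono[of "?c s" "?c t", OF mono[OF \<open>s \<le> t\<close>]] less[OF \<open>s < t\<close>]] by simp
    qed
    have grads: "gradient d (component (idx s)) (x s) \<in> reached (?c t)" if "s \<le> r" for s
    proof -
      have xs: "x s \<in> reached (?c s)" by (rule less) (use that Suc in simp)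
      have "{r. r < Suc s \<and> idx r = idx s} = insert s {r. r < s \<and> idx r = idx s}"
        by auto
      then have "Suc (?c s (idx s)) = ?c (Suc s) (idx s)" by simp
      then have "((?c s)(idx s := Suc (?c s (idx s)))) i \<le> ?c t i" for i
        using mono[of s i] mono[of "Suc s" i] that Suc by (cases "i = idx s") simp_all
      then have "reached ((?c s)(idx s := Suc (?c s (idx s)))) \<subseteq> reached (?c t)"
        by (rule reached_mono)
      then have "component_gradient (idx s) (x s) \<in> reached (?c t)"
        using component_gradient_reached[OF xs, of "idx s"] by (rule subsetD)
      moreover have "x s \<in> Rn d" using xs by (simp add: reached_def)
      ultimately show ?thesis using component_smooth(2)[OF idx] by simp
    qed
    have "x t \<in> span (x ` {..r} \<union> (\<lambda>s. gradient d (component (idx s)) (x s)) ` {..r})"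
      using step[of r] Suc by simp
    also have "\<dots> \<subseteq> reached (?c t)"
      using pts grads by (intro span_minimal subspace_reached) auto
    finally show ?thesis .
  qed
qed

text \<open>
  Completing a chain costs \<open>T\<close> calls, so with fewer than \<open>n T / 2\<close> calls more than half of the chains
  are incomplete.  Each of them has \<open>0\<close> at its last site and contributes the force of
  \<open>chain_force_lower_bound\<close>; the chains are orthogonal, so the squares add up.  The integer gain,
  \<open>n + 1\<close> instead of \<open>n\<close>, yields the strict inequality that the expectation needs.
\<close>

lemma average_gradient_large:
  assumes x: "x \<in> reached c" and c: "2 * (\<Sum>i=1..n. c i) < n * T"
  shows "lam\<^sup>2 * K\<^sup>2 * \<theta> ^ 3 * (real n + 1) / (384 * (real n)\<^sup>2) \<le> (norm (gradient d (average n component) x))\<^sup>2"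
proof -
  have xR: "x \<in> Rn d" using x by (simp add: reached_def)
  define v where "v = (\<lambda>i k. tension T \<theta> (\<lambda>k. site x (i, k)) k + \<theta>\<^sup>2 * well_slope (site x (i, k)))"
  define U where "U = {i \<in> {1..n}. c i < T}"
  have cardU: "n + 1 \<le> 2 * card U"
  proof -
    have "card ({1..n} - U) * T = (\<Sum>i\<in>{1..n} - U. T)" by simp
    also have "\<dots> \<le> (\<Sum>i\<in>{1..n} - U. c i)" by (intro sum_mono) (auto simp: U_def)
    also have "\<dots> \<le> (\<Sum>i=1..n. c i)" by (intro sum_mono2) auto
    finally have "2 * (card ({1..n} - U) * T) < n * T" using c by linarith
    then have "(2 * card ({1..n} - U)) * T < n * T" by (simp only: mult.assoc)
    then have "2 * card ({1..n} - U) < n" by simp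
    moreover have "card ({1..n} - U) = n - card U"
      by (subst card_Diff_subset) (auto simp: U_def)
    moreover have "card U \<le> card {1..n}" by (intro card_mono) (auto simp: U_def)
    ultimately show ?thesis by simp
  qed
  have wave: "\<theta> ^ 3 / 192 \<le> (\<Sum>k=1..T. (v i k)\<^sup>2)" if i: "i \<in> U" for i
  proof -
    let ?y = "ghost T \<theta> (\<lambda>k. site x (i, k))"
    have "site x (i, T) = 0" using x i T by (auto simp: reached_def site_def U_def)
    then have "?y 0 = (1 - \<theta>) * ?y 1 + \<theta> / 2" "?y T = 0" "?y (Suc T) = 0"
      using T by (auto simp: ghost_def)
    then have "\<theta> ^ 3 / 192 \<le> (\<Sum>k=1..T. (2 * ?y k - ?y (k - 1) - ?y (k + 1) + \<theta>\<^sup>2 * well_slope (?y k))\<^sup>2)"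
      by (rule chain_force_lower_bound[OF \<theta> T])
    also have "\<dots> = (\<Sum>k=1..T. (v i k)\<^sup>2)"
      by (intro sum.cong) (auto simp: v_def tension_def ghost_def)
    finally show ?thesis .
  qed
  have "(real n + 1) / 2 * (\<theta> ^ 3 / 192) \<le> real (card U) * (\<theta> ^ 3 / 192)"
    using cardU \<theta> by (intro mult_right_mono) auto
  also have "\<dots> = (\<Sum>i\<in>U. \<theta> ^ 3 / 192)" by simp
  also have "\<dots> \<le> (\<Sum>i\<in>U. \<Sum>k=1..T. (v i k)\<^sup>2)" by (intro sum_mono wave)
  also have "\<dots> \<le> (\<Sum>i=1..n. \<Sum>k=1..T. (v i k)\<^sup>2)"
    by (intro sum_mono2 sum_nonneg) (auto simp: U_def)
  finally have le: "(real n + 1) / 2 * (\<theta> ^ 3 / 192) \<le> (\<Sum>i=1..n. \<Sum>k=1..T. (v i k)\<^sup>2)" .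
  have "(norm (gradient d (average n component) x))\<^sup>2
      = (\<Sum>p\<in>sites. (lam * K / real n * v (fst p) (snd p))\<^sup>2)"
    unfolding average_gradient[OF xR] v_def
    by (subst norm_orthonormal_sum) (auto simp: u_orthonormal)
  also have "\<dots> = (lam * K / real n)\<^sup>2 * (\<Sum>i=1..n. \<Sum>k=1..T. (v i k)\<^sup>2)"
    unfolding sum.cartesian_product sum_distrib_left
    by (intro sum.cong) (auto simp: power_mult_distrib power_divide)
  finally have eq: "(norm (gradient d (average n component) x))\<^sup>2
      = (lam * K / real n)\<^sup>2 * (\<Sum>i=1..n. \<Sum>k=1..T. (v i k)\<^sup>2)" .
  have "lam\<^sup>2 * K\<^sup>2 * \<theta> ^ 3 * (real n + 1) / (384 * (real n)\<^sup>2)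
      = (lam * K / real n)\<^sup>2 * ((real n + 1) / 2 * (\<theta> ^ 3 / 192))"
    by (simp add: power_divide power_mult_distrib mult_ac)
  also have "\<dots> \<le> (norm (gradient d (average n component) x))\<^sup>2"
    unfolding eq by (intro mult_left_mono le) auto
  finally show ?thesis .
qed

lemma average_nonneg: "0 \<le> average n component x"
  unfolding average_def by (intro divide_nonneg_nonneg sum_nonneg component_nonneg) auto

lemma average_initial:
  assumes "x \<in> reached (\<lambda>_. 0)"
  shows "average n component x = lam\<^sup>2 * K * (\<theta> / 8 + \<theta>\<^sup>2 * real T / 4)"
proof -
  have z: "site x p = 0" if "p \<in> sites" for p
    using assms that by (auto simp: reached_def site_def)
  have "component i x = lam\<^sup>2 * K * (\<theta> / 8 + \<theta>\<^sup>2 * real T / 4)" if i: "i \<in> {1..n}" for i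
  proof -
    have c: "chain T \<theta> (\<lambda>k. site x (i, k)) = \<theta> / 8"
      unfolding chain_def using i T by (simp add: z power2_eq_square)
    have "(\<Sum>p\<in>sites. well (site x p)) = (\<Sum>p\<in>sites. 1/4)"
      by (intro sum.cong) (auto simp: z well_def)
    also have "\<dots> = real n * real T / 4" by (simp add: card_cartesian_product)
    finally have w: "(\<Sum>p\<in>sites. well (site x p)) = real n * real T / 4" .
    show ?thesis unfolding component_def c w using n by simp
  qed
  then have "(\<Sum>i=1..n. component i x) = (\<Sum>i=1..n. lam\<^sup>2 * K * (\<theta> / 8 + \<theta>\<^sup>2 * real T / 4))"
    by (intro sum.cong) auto
  then show ?thesis using n by (simp add: average_def)
qed

end

section \<open>From trajectories to expectations\<close>

lemma expected_gradient_norm_gt: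
  assumes "prob_space M" "0 < \<epsilon>" "\<epsilon> < G"
    and ae: "AE \<omega> in M. G \<le> norm (gradient d F (point \<omega> t))"
  shows "\<not> expected_gradient_norm d F M t \<le> ennreal \<epsilon>"
proof -
  interpret prob_space M by fact
  have "ennreal G = (\<integral>\<^sup>+ \<omega>. ennreal G \<partial>M)" by (simp add: emeasure_space_1)
  also have "\<dots> \<le> expected_gradient_norm d F M t"
    unfolding expected_gradient_norm_def
    by (intro nn_integral_mono_AE) (use ae in eventually_elim, auto intro: ennreal_leI)
  finally have "ennreal G \<le> expected_gradient_norm d F M t" .
  moreover have "ennreal \<epsilon> < ennreal G" using assms(2,3) by (simp add: ennreal_less_iff)
  ultimately show ?thesis by auto
qed

context hard_instance
begin

lemma expected_gradient_large:
  assumes alg: "linear_span_algorithm n x0 A" and start: "x0 d \<in> reached (\<lambda>_. 0)"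
    and t: "2 * t < n * T" and \<epsilon>: "0 < \<epsilon>"
    and scale: "lam\<^sup>2 * K\<^sup>2 * \<theta> ^ 3 = 384 * real n * \<epsilon>\<^sup>2"
  shows "\<not> expected_gradient_norm d (average n component) (A d component) t \<le> ennreal \<epsilon>"
proof -
  have "component i differentiable_on Rn d" if "i \<in> {1..n}" for i
    using component_smooth(1)[OF that] by (simp add: smooth_class_def)
  then have P: "prob_space (A d component)" and ae: "AE \<omega> in A d component.
      point \<omega> 0 = x0 d \<and> (\<forall>t. index \<omega> t \<in> {1..n} \<and> point \<omega> (Suc t) \<in> span
        ((\<lambda>s. point \<omega> s) ` {..t} \<union> (\<lambda>s. gradient d (component (index \<omega> s)) (point \<omega> s)) ` {..t}))"
    using alg unfolding linear_span_algorithm_def by blast+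
  define G where "G = sqrt (\<epsilon>\<^sup>2 * ((real n + 1) / real n))"
  have "\<epsilon>\<^sup>2 * 1 < \<epsilon>\<^sup>2 * ((real n + 1) / real n)"
    using \<epsilon> n by (intro mult_strict_left_mono) (auto simp: field_simps)
  then have "\<epsilon> < G" unfolding G_def using \<epsilon> real_less_rsqrt by simp
  moreover have "AE \<omega> in A d component. G \<le> norm (gradient d (average n component) (point \<omega> t))"
    using ae
  proof eventually_elim
    fix \<omega>
    assume h: "point \<omega> 0 = x0 d \<and> (\<forall>t. index \<omega> t \<in> {1..n} \<and> point \<omega> (Suc t) \<in> span
        ((\<lambda>s. point \<omega> s) ` {..t} \<union> (\<lambda>s. gradient d (component (index \<omega> s)) (point \<omega> s)) ` {..t}))"
    let ?c = "\<lambda>i. card {s. s < t \<and> index \<omega> s = i}"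
    have reach: "point \<omega> t \<in> reached ?c"
      by (rule trajectory_reached[of "point \<omega>" "index \<omega>" t]) (use h start in auto)
    have "(\<Sum>i=1..n. ?c i) = t"
      using sum.group[of "{..<t}" "{1..n}" "index \<omega>" "\<lambda>_. 1 :: nat"] h by (auto simp: image_subset_iff)
    then have "lam\<^sup>2 * K\<^sup>2 * \<theta> ^ 3 * (real n + 1) / (384 * (real n)\<^sup>2)
        \<le> (norm (gradient d (average n component) (point \<omega> t)))\<^sup>2"
      using average_gradient_large[OF reach] t by simp
    also have "lam\<^sup>2 * K\<^sup>2 * \<theta> ^ 3 * (real n + 1) / (384 * (real n)\<^sup>2) = \<epsilon>\<^sup>2 * ((real n + 1) / real n)"
      unfolding scale using n by (simp add: power2_eq_square)
    finally show "G \<le> norm (gradient d (average n component) (point \<omega> t))"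
      unfolding G_def by (simp add: real_le_lsqrt)
  qed
  ultimately show ?thesis using expected_gradient_norm_gt[OF P \<epsilon>] by blast
qed

end

section \<open>Choice of the parameters\<close>

lemma hard_instance_exists:
  fixes x0 :: "nat \<Rightarrow> rvec"
  assumes "n \<ge> 1" "T \<ge> 1" "lam > 0" "K > 0" "0 < \<theta>" "\<theta> \<le> 1" and x0: "x0 (Suc (n * T)) \<in> Rn (Suc (n * T))"
  obtains u where "hard_instance n T (Suc (n * T)) u lam K \<theta>"
    "x0 (Suc (n * T)) \<in> hard_instance.reached n T (Suc (n * T)) u (\<lambda>_. 0)"
proof -
  obtain e where e: "\<And>k. k < n * T \<Longrightarrow> e k \<in> Rn (Suc (n * T))"
    "\<And>k. k < n * T \<Longrightarrow> inner (e k) (x0 (Suc (n * T))) = 0"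
    "\<And>j k. j < n * T \<Longrightarrow> k < n * T \<Longrightarrow> inner (e j) (e k) = (if j = k then 1 else 0)"
    by (rule orthonormal_family_orthogonal_to[OF x0]) blast
  define pos where "pos = (\<lambda>p :: nat \<times> nat. (fst p - 1) * T + (snd p - 1))"
  have pos: "pos p < n * T" if "p \<in> {1..n} \<times> {1..T}" for p
  proof -
    have "fst p - 1 \<le> n - 1" using that by auto
    then have "(fst p - 1) * T \<le> (n - 1) * T" by (rule mult_right_mono) simp
    moreover have "snd p - 1 < T" using that assms(2) by auto
    ultimately have "pos p < (n - 1) * T + T" unfolding pos_def by linarith
    also have "(n - 1) * T + T = n * T" using assms(1) by (simp add: algebra_simps)
    finally show ?thesis .
  qed
  have inj: "p = q" if "p \<in> {1..n} \<times> {1..T}" "q \<in> {1..n} \<times> {1..T}" "pos p = pos q" for p q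
  proof -
    have dm: "pos p div T = fst p - 1" "pos p mod T = snd p - 1" if "p \<in> {1..n} \<times> {1..T}" for p
      using that assms(2) by (auto simp: pos_def div_mult_self3)
    show ?thesis using dm[OF that(1)] dm[OF that(2)] that by (auto simp: prod_eq_iff)
  qed
  have H: "hard_instance n T (Suc (n * T)) (\<lambda>p. e (pos p)) lam K \<theta>"
    using assms e pos inj by unfold_locales auto
  moreover have "x0 (Suc (n * T)) \<in> hard_instance.reached n T (Suc (n * T)) (\<lambda>p. e (pos p)) (\<lambda>_. 0)"
    unfolding hard_instance.reached_def[OF H] using x0 e(2) pos by auto
  ultimately show thesis by (rule that)
qed

text \<open>
  The spring constant \<open>K = L / 5\<close> is dictated by the upper curvature bound and \<open>s = K \<theta>\<^sup>2\<close>, the strength of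
  the wells in the average, by \<open>s \<le> n \<sigma>\<close> and \<open>\<theta> \<le> 1\<close>.  Then \<open>Y = K \<theta> = \<surd>(K s)\<close> is the minimum in
  the claim up to a factor \<open>5\<close>.  The scale for which the gradient is just above \<open>\<epsilon>\<close> has
  \<open>lam\<^sup>2 = 384 n \<epsilon>\<^sup>2 / (K\<^sup>2 \<theta>\<^sup>3)\<close>, and the initial value \<open>lam\<^sup>2 K (\<theta> / 8 + \<theta>\<^sup>2 T / 4)\<close> is then the left-hand
  side of the bound by \<open>\<Delta>\<close>.  The hypothesis on \<open>\<epsilon>\<close> implies \<open>n \<epsilon>\<^sup>2 / s \<le> \<Delta> / 200\<close>; it keeps the first
  summand small and makes room for a chain of length \<open>T \<ge> 1\<close> in the second.
\<close>

lemma parameter_choice: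
  fixes L \<sigma> \<Delta> \<epsilon> :: real
  assumes n: "n \<ge> 1" and pos: "L > 0" "\<sigma> > 0" "\<Delta> > 0" "\<epsilon> > 0"
    and \<epsilon>: "\<epsilon>\<^sup>2 \<le> min (\<Delta> * L / real n) (\<Delta> * \<sigma>) / 10 ^ 3"
  defines "M \<equiv> min (sqrt (real n * \<sigma> * L)) L"
  obtains \<theta> T where "0 < \<theta>" "\<theta> \<le> 1" "T \<ge> 1" "L / 5 * \<theta>\<^sup>2 / real n \<le> \<sigma>"
    "48 * real n * \<epsilon>\<^sup>2 / (L / 5 * \<theta>\<^sup>2) + 96 * real n * \<epsilon>\<^sup>2 * real T / (L / 5 * \<theta>) \<le> \<Delta>"
    "real (Suc (n * T)) \<le> \<Delta> / \<epsilon>\<^sup>2 * M" "\<Delta> / \<epsilon>\<^sup>2 * M / 2000 \<le> real (n * T)"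
proof -
  define K where "K = L / 5"
  define s where "s = min (real n * \<sigma>) K"
  define \<theta> where "\<theta> = sqrt (s / K)"
  define Y where "Y = K * \<theta>"
  define e2 where "e2 = real n * \<epsilon>\<^sup>2"
  have K: "K > 0" and s: "s > 0" "s \<le> K" "s \<le> real n * \<sigma>" and e2: "e2 > 0"
    using pos n by (auto simp: K_def s_def e2_def)
  have \<theta>: "0 < \<theta>" "\<theta> \<le> 1" and \<theta>2: "K * \<theta>\<^sup>2 = s" using s K by (auto simp: \<theta>_def)
  have Y: "Y > 0" using K \<theta> by (simp add: Y_def)
  have sY: "s \<le> Y"
  proof -
    have "s = K * \<theta> * \<theta>" using \<theta>2 by (simp add: power2_eq_square)
    also have "\<dots> \<le> K * \<theta> * 1" using K \<theta> by (intro mult_left_mono) auto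
    finally show ?thesis by (simp add: Y_def)
  qed
  have Ysq: "Y\<^sup>2 = K * s" using \<theta>2 by (simp add: Y_def power_mult_distrib power2_eq_square mult.assoc mult.left_commute)
  have "1000 * \<epsilon>\<^sup>2 \<le> \<Delta> * L / real n" "1000 * \<epsilon>\<^sup>2 \<le> \<Delta> * \<sigma>" using \<epsilon> by auto
  then have "1000 * e2 \<le> \<Delta> * L" "1000 * e2 \<le> \<Delta> * (real n * \<sigma>)"
    using n by (auto simp: e2_def field_simps)
  then have es: "200 * e2 \<le> \<Delta> * s"
    using e2 by (cases "real n * \<sigma> \<le> K") (auto simp: s_def K_def min_def)
  have MY: "Y \<le> M" "M \<le> 5 * Y"
  proof -
    have "Y\<^sup>2 \<le> real n * \<sigma> * L"
    proof -
      have "Y\<^sup>2 \<le> K * (real n * \<sigma>)" unfolding Ysq using K s by (intro mult_left_mono) auto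
      also have "\<dots> \<le> L * (real n * \<sigma>)" using pos by (intro mult_right_mono) (auto simp: K_def)
      finally show ?thesis by (simp add: mult_ac)
    qed
    moreover have "Y \<le> K" using \<theta> K by (simp add: Y_def)
    ultimately show "Y \<le> M" using pos by (simp add: M_def K_def real_le_rsqrt)
    show "M \<le> 5 * Y"
    proof (cases "real n * \<sigma> \<le> K")
      case True
      then have "real n * \<sigma> * L = 5 * Y\<^sup>2" by (simp add: Ysq s_def K_def min_def)
      then have "sqrt (real n * \<sigma> * L) \<le> 5 * Y" using Y by (intro real_le_lsqrt) (auto simp: power_mult_distrib)
      then show ?thesis by (simp add: M_def min.coboundedI1)
    next
      case False
      then have "Y\<^sup>2 = K\<^sup>2" using Ysq by (simp add: s_def min_def power2_eq_square)
      then have "Y = K" using Y K by (simp add: power2_eq_iff_nonneg)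
      then show ?thesis by (simp add: M_def K_def)
    qed
  qed
  \<comment> \<open>The gap allows chains of length \<open>X\<close>, up to a constant. As \<open>X / 200 \<ge> 1\<close>, rounding
      down loses at most a factor 2.\<close>
  define X where "X = \<Delta> * Y / e2"
  have X: "X \<ge> 200"
  proof -
    have "200 * e2 \<le> \<Delta> * Y"
      using es mult_left_mono[OF sY less_imp_le[OF pos(3)]] by (rule order_trans)
    then show ?thesis using e2 by (simp add: X_def le_divide_eq)
  qed
  define T where "T = nat \<lfloor>X / 200\<rfloor>"
  have T: "T \<ge> 1" "real T \<le> X / 200" "X / 400 \<le> real T"
  proof -
    have f: "1 \<le> \<lfloor>X / 200\<rfloor>" using X by simp
    then show "T \<ge> 1" unfolding T_def by linarith
    have r: "real T = real_of_int \<lfloor>X / 200\<rfloor>" unfolding T_def by (rule of_nat_nat) (use f in linarith)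
    show "real T \<le> X / 200" unfolding r by (rule of_int_floor_le)
    have "X / 200 < real_of_int \<lfloor>X / 200\<rfloor> + 1" by linarith
    moreover have "1 \<le> real_of_int \<lfloor>X / 200\<rfloor>" using f by linarith
    ultimately show "X / 400 \<le> real T" unfolding r by linarith
  qed
  have nX: "real n * X = \<Delta> / \<epsilon>\<^sup>2 * Y" using n pos by (simp add: X_def e2_def)
  have dM: "\<Delta> / \<epsilon>\<^sup>2 * Y \<le> \<Delta> / \<epsilon>\<^sup>2 * M" "\<Delta> / \<epsilon>\<^sup>2 * M \<le> \<Delta> / \<epsilon>\<^sup>2 * (5 * Y)"
    using MY pos by (intro mult_left_mono; simp)+
  show thesis
  proof (rule that[of \<theta> T])
    show "0 < \<theta>" "\<theta> \<le> 1" "T \<ge> 1" by (fact \<theta> T)+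
    show "L / 5 * \<theta>\<^sup>2 / real n \<le> \<sigma>"
      using s(3) n unfolding K_def[symmetric] \<theta>2 by (simp add: divide_le_eq mult.commute)
    have "e2 / s \<le> \<Delta> / 200" using es s by (simp add: divide_le_eq)
    moreover have "e2 * real T / Y \<le> \<Delta> / 200"
      using T(2) e2 Y by (simp add: X_def field_simps)
    ultimately have "48 * (e2 / s) + 96 * (e2 * real T / Y) \<le> \<Delta>" using pos by linarith
    then show "48 * real n * \<epsilon>\<^sup>2 / (L / 5 * \<theta>\<^sup>2) + 96 * real n * \<epsilon>\<^sup>2 * real T / (L / 5 * \<theta>) \<le> \<Delta>"
      unfolding K_def[symmetric] \<theta>2 Y_def[symmetric] e2_def by (simp add: mult.assoc)
    have "1 \<le> n * T" using n T(1) by simp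
    then have "real (Suc (n * T)) \<le> 2 * (real n * real T)" by (simp del: of_nat_mult flip: of_nat_mult)
    also have "\<dots> \<le> 2 * (real n * (X / 200))" using T(2) by (intro mult_left_mono) auto
    also have "\<dots> \<le> real n * X" using X by simp
    finally show "real (Suc (n * T)) \<le> \<Delta> / \<epsilon>\<^sup>2 * M" using nX dM by simp
    have "real n * (X / 400) \<le> real n * real T" using T(3) by (intro mult_left_mono) auto
    moreover have "\<Delta> / \<epsilon>\<^sup>2 * M \<le> 5 * (real n * X)"
      unfolding nX using dM(2) by (simp only: mult.left_commute[of 5])
    ultimately have "\<Delta> / \<epsilon>\<^sup>2 * M \<le> real (n * T) * 2000" by simp
    then show "\<Delta> / \<epsilon>\<^sup>2 * M / 2000 \<le> real (n * T)" by (rule iffD2[OF divide_le_eq_numeral1(1)])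
  qed
qed

theorem theorem4p7:
  shows "\<exists>c>0. \<exists>C>0.
    \<forall>(n::nat) (x0 :: nat \<Rightarrow> rvec) (A :: algorithm) (L::real) (\<sigma>::real) (\<Delta>::real) (\<epsilon>::real).
      n \<ge> 1 \<longrightarrow> linear_span_algorithm n x0 A \<longrightarrow>
      L > 0 \<longrightarrow> \<sigma> > 0 \<longrightarrow> \<Delta> > 0 \<longrightarrow> \<epsilon> > 0 \<longrightarrow>
      \<epsilon>\<^sup>2 \<le> min (\<Delta> * L / real n) (\<Delta> * \<sigma>) / 10 ^ 3 \<longrightarrow>
      (\<exists>(d::nat) (f :: nat \<Rightarrow> rvec \<Rightarrow> real).
         real d \<le> C * (\<Delta> / \<epsilon>\<^sup>2 * min (sqrt (real n * \<sigma> * L)) L) \<and>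
         (\<forall>i\<in>{1..n}. f i \<in> smooth_class d (- \<sigma>) L) \<and>
         bdd_below (average n f ` Rn d) \<and>
         average n f (x0 d) - (INF x\<in>Rn d. average n f x) \<le> \<Delta> \<and>
         (\<exists>N::nat. c * (\<Delta> / \<epsilon>\<^sup>2 * min (sqrt (real n * \<sigma> * L)) L) \<le> real N \<and>
            (\<forall>t<N. \<not> expected_gradient_norm d (average n f) (A d f) t \<le> ennreal \<epsilon>)))"
proof (rule exI[of _ "1/4000"], intro conjI, simp, rule exI[of _ 1], intro conjI allI impI, simp)
  fix n :: nat and x0 A and L \<sigma> \<Delta> \<epsilon> :: real
  assume n: "n \<ge> 1" and alg: "linear_span_algorithm n x0 A"
    and pos: "L > 0" "\<sigma> > 0" "\<Delta> > 0" "\<epsilon> > 0"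
    and \<epsilon>: "\<epsilon>\<^sup>2 \<le> min (\<Delta> * L / real n) (\<Delta> * \<sigma>) / 10 ^ 3"
  let ?M = "\<Delta> / \<epsilon>\<^sup>2 * min (sqrt (real n * \<sigma> * L)) L"
  obtain \<theta> T where \<theta>: "0 < \<theta>" "\<theta> \<le> 1" and T: "T \<ge> 1" and \<sigma>: "L / 5 * \<theta>\<^sup>2 / real n \<le> \<sigma>"
    and gap: "48 * real n * \<epsilon>\<^sup>2 / (L / 5 * \<theta>\<^sup>2) + 96 * real n * \<epsilon>\<^sup>2 * real T / (L / 5 * \<theta>) \<le> \<Delta>"
    and dim: "real (Suc (n * T)) \<le> ?M" and len: "?M / 2000 \<le> real (n * T)"
    by (rule parameter_choice[OF n pos \<epsilon>]) blast
  define K where "K = L / 5"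
  define lam where "lam = sqrt (384 * real n * \<epsilon>\<^sup>2 / (K\<^sup>2 * \<theta> ^ 3))"
  have K: "K > 0" using pos by (simp add: K_def)
  have lam2: "lam\<^sup>2 = 384 * real n * \<epsilon>\<^sup>2 / (K\<^sup>2 * \<theta> ^ 3)"
    using K \<theta> by (simp add: lam_def)
  have lam: "lam > 0" using K \<theta> pos n by (simp add: lam_def)
  define d where "d = Suc (n * T)"
  have x0: "x0 d \<in> Rn d" using alg by (simp add: linear_span_algorithm_def)
  obtain u where H: "hard_instance n T d u lam K \<theta>"
    and start: "x0 d \<in> hard_instance.reached n T d u (\<lambda>_. 0)"
    using hard_instance_exists[OF n T lam K \<theta>, of x0] x0 unfolding d_def by blast
  interpret hard_instance n T d u lam K \<theta> by (rule H)
  let ?F = "average n component"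
  have smooth: "component i \<in> smooth_class d (- \<sigma>) L" if "i \<in> {1..n}" for i
    using component_smooth(1)[OF that] smooth_class_mono[of "- \<sigma>" "- (K * \<theta>\<^sup>2 / real n)" "5 * K" L] \<sigma>
    by (auto simp: K_def)
  have bdd: "bdd_below (?F ` Rn d)" by (rule bdd_belowI2[of _ 0]) (rule average_nonneg)
  have "0 \<le> (INF x\<in>Rn d. ?F x)"
    using x0 by (intro cINF_greatest average_nonneg) auto
  moreover have "?F (x0 d) = 48 * real n * \<epsilon>\<^sup>2 / (K * \<theta>\<^sup>2) + 96 * real n * \<epsilon>\<^sup>2 * real T / (K * \<theta>)"
    unfolding average_initial[OF start] lam2 using K \<theta>
    by (simp add: field_simps power2_eq_square power3_eq_cube)
  ultimately have initial: "?F (x0 d) - (INF x\<in>Rn d. ?F x) \<le> \<Delta>"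
    using gap unfolding K_def by linarith
  \<comment> \<open>Rounded up, so that \<open>t < N\<close> is equivalent to \<open>2 t < n T\<close>.\<close>
  define N where "N = (n * T + 1) div 2"
  have "real (n * T) \<le> 2 * real N" unfolding N_def by linarith
  moreover have "1 / 4000 * ?M = (?M / 2000) / 2" by simp
  ultimately have N: "1 / 4000 * ?M \<le> real N"
    using len by (metis (no_types, opaque_lifting) divide_le_eq_numeral1(1) mult.commute order_trans)
  have late: "\<not> expected_gradient_norm d ?F (A d component) t \<le> ennreal \<epsilon>" if "t < N" for t
  proof (rule expected_gradient_large[where ?x0.0 = x0])
    show "linear_span_algorithm n x0 A" "x0 d \<in> reached (\<lambda>_. 0)" "0 < \<epsilon>" by (fact alg start pos)+
    show "2 * t < n * T" using that unfolding N_def by linarith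
    show "lam\<^sup>2 * K\<^sup>2 * \<theta> ^ 3 = 384 * real n * \<epsilon>\<^sup>2" unfolding lam2 using K \<theta> by simp
  qed
  show "\<exists>d f. real d \<le> 1 * ?M \<and> (\<forall>i\<in>{1..n}. f i \<in> smooth_class d (- \<sigma>) L) \<and>
         bdd_below (average n f ` Rn d) \<and>
         average n f (x0 d) - (INF x\<in>Rn d. average n f x) \<le> \<Delta> \<and>
         (\<exists>N::nat. 1 / 4000 * ?M \<le> real N \<and>
            (\<forall>t<N. \<not> expected_gradient_norm d (average n f) (A d f) t \<le> ennreal \<epsilon>))"
    using dim smooth bdd initial N late unfolding d_def[symmetric]
    by (intro exI[of _ d] exI[of _ component] conjI ballI exI[of _ N] allI impI) auto
qed

end
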